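(* Let $K$ be a field, let $S=K[x_1,\dots,x_n]$ be a polynomial ring in $n$ variables over $K$, and let $I_{n,d}$ be the squarefree Veronese ideal in $S$, generated by all squarefree monomials of degree $d$. (1) If $1\le d\le n<5d+4$, then $\operatorname{sdepth}(I_{n,d})=\left\lfloor \binom{n}{d+1}\Big/\binom{n}{d}\right\rfloor+d$. (2) If $d\ge 1$ and $n\ge 5d+4$, then $$d+3\le \operatorname{sdepth}(I_{n,d})\le \left\lfloor \binom{n}{d+1}\Big/\binom{n}{d}\right\rfloor+d.$$
   Context: Let $K$ be a field and $S=K[x_1,\dots,x_n]$ with its natural $\mathbb{Z}^n$-grading. A Stanley decomposition of a finitely generated $\mathbb{Z}^n$-graded $S$-module $M$ (for instance a monomial ideal $M=I\subseteq S$) is a representation of $M$ as a finite direct sum of $K$-vector spaces $\mathcal{D}: M=\bigoplus_{i=1}^m u_iK[Z_i]$, where each $u_i\in M$ is homogeneous (with respect to the $\mathbb{Z}^n$-grading) and each $Z_i$ is a subset of $\{x_1,\dots,x_n\}$. The Stanley depth of this decomposition is $\operatorname{sdepth}(\mathcal{D})=\min\{|Z_i| : 1\le i\le m\}$. The Stanley depth of $M$ is $\operatorname{sdepth}(M)=\max\{\operatorname{sdepth}(\mathcal{D}) : \mathcal{D}\text{ is a Stanley decomposition of }M\}$. *)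

theory Defs
  imports Complex_Main "HOL-Library.FuncSet" "HOL-Library.Cardinality" "HOL-Library.Poly_Mapping"
begin

text \<open>
  The type \<open>('n, 'k) mpoly\<close> is the whole polynomial ring \<open>S = K[x_i | i in 'n]\<close>:
  exponent vectors are maps from \<open>'n\<close> to \<open>nat\<close>, polynomials are finitely supported maps from
  exponent vectors to \<open>'k\<close>, and multiplication is the convolution product of
  \<open>HOL-Library.Poly_Mapping\<close>. For \<open>'n\<close> finite it is the polynomial ring in \<open>n = CARD('n)\<close>
  variables. The variable \<open>x_i\<close> is identified with its index \<open>i\<close>.
\<close>

type_synonym ('n, 'k) mpoly = "('n \<Rightarrow>\<^sub>0 nat) \<Rightarrow>\<^sub>0 'k"

definition poly_subring :: "'n set \<Rightarrow> ('n, 'k::zero) mpoly set"  (\<open>K[_]\<close>) where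
  "K[Z] = {p. \<forall>m \<in> Poly_Mapping.keys p. Poly_Mapping.keys m \<subseteq> Z}"

text \<open>
  The component of degree \<open>a\<close> in the natural $\mathbb{Z}^n$-grading of \<open>S\<close>: the line spanned
  by \<open>x^a\<close> if \<open>a\<close> has no negative entry, and zero otherwise.
\<close>

definition mpoly_grading :: "('n \<Rightarrow> int) \<Rightarrow> ('n, 'k::zero) mpoly set" where
  "mpoly_grading a = {p. \<forall>m \<in> Poly_Mapping.keys p. \<forall>i. int (Poly_Mapping.lookup m i) = a i}"

text \<open>
  A $\mathbb{Z}^n$-graded module \<open>M\<close> is given as a graded submodule of an ambient module \<open>'m\<close>, with
  action \<open>smul\<close> of \<open>S\<close> and homogeneous components \<open>grading a\<close>. A family of subspaces has direct
  sum \<open>M\<close> iff adding up gives a bijection from their product onto \<open>M\<close>.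
  As usual, writing \<open>u K[Z]\<close> includes that it is a free \<open>K[Z]\<close>-module on \<open>u\<close>
  (otherwise \<open>K = 1 K[x]\<close> would be a Stanley decomposition of the module \<open>K = S/(x)\<close>);
  for \<open>u\<close> in an ideal of \<open>S\<close> this just says that \<open>u\<close> is nonzero.
\<close>

definition stanley_space :: "(('n, 'k::zero) mpoly \<Rightarrow> 'm \<Rightarrow> 'm) \<Rightarrow> 'm \<Rightarrow> 'n set \<Rightarrow> 'm set" where
  "stanley_space smul u Z = (\<lambda>p. smul p u) ` K[Z]"

definition direct_sum_decomp :: "nat \<Rightarrow> (nat \<Rightarrow> 'm::comm_monoid_add set) \<Rightarrow> 'm set \<Rightarrow> bool" where
  "direct_sum_decomp r V M \<longleftrightarrow> bij_betw (\<lambda>v. \<Sum>i<r. v i) (Pi\<^sub>E {..<r} V) M"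

definition stanley_decomposition ::
  "(('n, 'k::zero) mpoly \<Rightarrow> 'm \<Rightarrow> 'm) \<Rightarrow> (('n \<Rightarrow> int) \<Rightarrow> 'm set) \<Rightarrow> 'm::comm_monoid_add set
    \<Rightarrow> nat \<Rightarrow> (nat \<Rightarrow> 'm) \<Rightarrow> (nat \<Rightarrow> 'n set) \<Rightarrow> bool" where
  "stanley_decomposition smul grading M r u Z \<longleftrightarrow>
     (\<forall>i<r. u i \<in> M \<and> (\<exists>a. u i \<in> grading a) \<and> inj_on (\<lambda>p. smul p (u i)) K[Z i]) \<and>
     direct_sum_decomp r (\<lambda>i. stanley_space smul (u i) (Z i)) M"

definition sdepth_decomposition :: "nat \<Rightarrow> (nat \<Rightarrow> 'n set) \<Rightarrow> nat" where
  "sdepth_decomposition r Z = Min {card (Z i) |i. i < r}"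

text \<open>
  Meaningful for nonzero \<open>M\<close> only: then all decompositions are nonempty and have
  Stanley depth at most \<open>n\<close>.
\<close>

definition sdepth ::
  "(('n::finite, 'k::zero) mpoly \<Rightarrow> 'm \<Rightarrow> 'm) \<Rightarrow> (('n \<Rightarrow> int) \<Rightarrow> 'm set)
    \<Rightarrow> 'm::comm_monoid_add set \<Rightarrow> nat" where
  "sdepth smul grading M =
     Max {sdepth_decomposition r Z |r u Z. stanley_decomposition smul grading M r u Z}"

abbreviation sdepth_ideal :: "('n::finite, 'k::field) mpoly set \<Rightarrow> nat" where
  "sdepth_ideal \<equiv> sdepth (*) mpoly_grading"

text \<open>The span in \<open>S\<close> regarded as a module over itself is the generated ideal.\<close>

interpretation mpoly_module: module "(*) :: ('n, 'k::field) mpoly \<Rightarrow> _ \<Rightarrow> _"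
  by standard (simp_all add: algebra_simps)

definition squarefree_monomials :: "nat \<Rightarrow> ('n::finite, 'k::field) mpoly set" where
  "squarefree_monomials d =
     {Poly_Mapping.single m 1 |m.
        (\<forall>i. Poly_Mapping.lookup m i \<le> 1) \<and>
        (\<Sum>i\<in>UNIV. Poly_Mapping.lookup m i) = d}"

definition squarefree_veronese :: "nat \<Rightarrow> ('n::finite, 'k::field) mpoly set" where
  "squarefree_veronese d = module.span (*) (squarefree_monomials d)"

end

theory Submission
  imports Defs "HOL-Library.Disjoint_Sets"
begin

text \<open>
  By Herzog, Vladoiu and Zheng's method it suffices to partition the subsets of size at least \<open>d\<close>
  of an \<open>n\<close>-element set into intervals \<open>[A, B]\<close> with \<open>card B \<ge> d + k\<close>: such an interval gives the
  Stanley space \<open>x\<^sup>A K[B]\<close>. The upper bound counts squarefree monomials of degree \<open>d + 1\<close>: each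
  squarefree \<open>x\<^sup>A\<close> of degree \<open>d\<close> generates its own Stanley space.

  For \<open>k \<le> 3\<close> such a partition exists whenever \<open>n \<ge> (k + 1) d + k\<close>, and by induction on \<open>n\<close> only
  equality matters. Put the points on a circle and, given a set \<open>C\<close>, repeatedly delete a point of \<open>C\<close>
  together with the next \<open>k\<close> remaining points if these lie outside \<open>C\<close>. The set \<open>S\<close> of surviving
  points does not depend on the choices. If \<open>card S = k\<close>, then \<open>C\<close> lies in the interval
  \<open>[C - S, C \<union> S]\<close>, all members of which have the same survivors, and \<open>card (C - S) = d\<close>. Every
  other \<open>C\<close> has at least \<open>d + 2\<close> elements, which settles \<open>k \<le> 2\<close>. For \<open>k = 3\<close> and \<open>card C = d + 2\<close>,
  fewer than half of the survivors lie in \<open>C\<close>, so \<open>C\<close> can be enlarged injectively by a survivor,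
  and this does not change the survivors; the injection comes from the case \<open>k = 1\<close>.
\<close>

section \<open>Collapsing circular words\<close>

text \<open>A list stands for a circular word, read up to rotation. The rotation brings the deleted
  block to the front, so \<open>ys\<close> starts right behind the gap.\<close>

definition collapse_step :: "'a set \<Rightarrow> nat \<Rightarrow> 'a list \<Rightarrow> 'a list \<Rightarrow> bool" where
  "collapse_step C k xs ys \<longleftrightarrow>
     (\<exists>i a bs. rotate i xs = a # bs @ ys \<and> a \<in> C \<and> length bs = k \<and> set bs \<inter> C = {})"

definition irreducible_word :: "'a set \<Rightarrow> nat \<Rightarrow> 'a list \<Rightarrow> bool" where
  "irreducible_word C k xs \<longleftrightarrow> (\<nexists>ys. collapse_step C k xs ys)"

text \<open>The base clause allows an arbitrary rotation instead of equality, so that the relation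
  does not depend on where the circular word is cut open.\<close>

inductive collapses :: "'a set \<Rightarrow> nat \<Rightarrow> 'a list \<Rightarrow> 'a list \<Rightarrow> bool" for C k where
  rotation: "collapses C k xs (rotate i xs)"
| step: "collapse_step C k xs ys \<Longrightarrow> collapses C k ys zs \<Longrightarrow> collapses C k xs zs"

section \<open>Confluence of the reduction\<close>

lemma rotate_inverse: "\<exists>j. rotate j (rotate i xs) = xs"
proof (cases "xs = []")
  case False
  let ?j = "length xs - i mod length xs"
  have "(?j + i) mod length xs = 0"
  proof -
    have "(?j + i) mod length xs = (?j + i mod length xs) mod length xs"
      by (simp add: mod_add_right_eq)
    also have "?j + i mod length xs = length xs" using False by (simp add: less_imp_le)
    finally show ?thesis by simp
  qed
  then have "rotate (?j + i) xs = xs" by (simp add: rotate_id)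
  then show ?thesis by (metis rotate_rotate)
qed auto

lemma collapse_step_rotate: "collapse_step C k xs ys \<Longrightarrow> collapse_step C k (rotate j xs) ys"
proof -
  assume "collapse_step C k xs ys"
  moreover obtain l where "rotate l (rotate j xs) = xs" using rotate_inverse by metis
  then have "rotate i xs = rotate (i + l) (rotate j xs)" for i by (simp flip: rotate_rotate)
  ultimately show ?thesis unfolding collapse_step_def by metis
qed

lemma collapses_rotate: "collapses C k xs ys \<Longrightarrow> collapses C k (rotate j xs) ys"
proof (induction rule: collapses.induct)
  case (rotation xs i)
  obtain l where "rotate l (rotate j xs) = xs" using rotate_inverse by metis
  then have "rotate i xs = rotate (i + l) (rotate j xs)" by (simp flip: rotate_rotate)
  then show ?case by (metis collapses.rotation)
next
  case (step xs ys zs)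
  then show ?case by (meson collapses.step collapse_step_rotate)
qed

lemma irreducible_word_rotate: "irreducible_word C k (rotate j xs) \<longleftrightarrow> irreducible_word C k xs"
  unfolding irreducible_word_def by (metis collapse_step_rotate rotate_inverse)

text \<open>Two occurrences of the pattern are equal or disjoint, as its first letter is the only one in \<open>C\<close>.\<close>

lemma collapse_step_diamond:
  assumes "collapse_step C k xs ys" "collapse_step C k xs ys'"
  shows "ys = ys' \<or> (\<exists>zs i. collapse_step C k ys zs \<and> collapse_step C k ys' (rotate i zs))"
proof -
  from assms obtain i a bs where 1: "rotate i xs = a # bs @ ys" "a \<in> C" "length bs = k" "set bs \<inter> C = {}"
    unfolding collapse_step_def by auto
  define L where "L = a # bs @ ys"
  have "collapse_step C k L ys'" using collapse_step_rotate[OF assms(2), of i] 1 L_def by simp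
  then obtain j0 a' bs' where 2: "rotate j0 L = a' # bs' @ ys'" "a' \<in> C" "length bs' = k" "set bs' \<inter> C = {}"
    unfolding collapse_step_def by auto
  define j where "j = j0 mod length L"
  have jl: "j < length L" unfolding j_def by (simp add: L_def)
  have eq: "drop j L @ take j L = a' # bs' @ ys'"
    using 2(1) by (simp add: rotate_drop_take j_def)
  have hd: "L ! j = a'" using eq jl by (metis Cons_nth_drop_Suc append_Cons list.inject)
  \<comment> \<open>\<open>j\<close> is the distance from the first block to the second. The blocks
    coincide for \<open>j = 0\<close>; for \<open>0 < j \<le> k\<close> the head \<open>a'\<close>
    would lie in \<open>bs\<close>; in the third case the blocks are disjoint; in the last one the
    second block wraps around and \<open>bs'\<close> would contain \<open>a\<close>.\<close>
  consider "j = 0" | "0 < j" "j \<le> k" | "k < j" "j + Suc k \<le> length L" | "k < j" "length L < j + Suc k" by linarith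
  then show ?thesis
  proof cases
    case 1
    then have "bs @ ys = bs' @ ys'" using eq L_def by simp
    then show ?thesis using 2(3) \<open>length bs = k\<close> by simp
  next
    case 2
    then have "L ! j \<in> set bs" using \<open>length bs = k\<close> unfolding L_def by (cases j) (auto simp: nth_append)
    then show ?thesis using \<open>a' \<in> C\<close> hd \<open>set bs \<inter> C = {}\<close> by auto
  next
    case 3
    then have dj: "drop j L = drop (j - Suc k) ys" "take j L = a # bs @ take (j - Suc k) ys"
      using \<open>length bs = k\<close> unfolding L_def by (cases j; simp)+
    define p where "p = take (j - Suc k) ys"
    define r where "r = drop (j - Suc k) ys"
    have ys: "ys = p @ r" unfolding p_def r_def by simp
    have lr: "length r \<ge> Suc k" using 3 \<open>length bs = k\<close> unfolding r_def L_def by simp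
    define q where "q = drop (Suc k) r"
    have e2: "r @ a # bs @ p = a' # bs' @ ys'" using eq dj p_def r_def by simp
    have "take (Suc k) (r @ a # bs @ p) = take (Suc k) (a' # bs' @ ys')" using e2 by simp
    then have "take (Suc k) r = a' # bs'" using lr 2(3) by simp
    then have r: "r = a' # bs' @ q" unfolding q_def
      by (metis append_Cons append_take_drop_id)
    have ys': "ys' = q @ a # bs @ p" using e2 r by simp
    have s1: "collapse_step C k ys (q @ p)"
      unfolding collapse_step_def using 2 ys r
      by (intro exI[of _ "length p"] exI[of _ a'] exI[of _ bs']) (simp add: rotate_append)
    have s2: "collapse_step C k ys' (p @ q)"
      unfolding collapse_step_def using 1 ys'
      by (intro exI[of _ "length q"] exI[of _ a] exI[of _ bs]) (simp add: rotate_append)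
    \<comment> \<open>The common reduct is cut open at different places on the two sides, which is
      why the conclusion carries a rotation.\<close>
    have "p @ q = rotate (length q) (q @ p)" by (simp add: rotate_append)
    then show ?thesis using s1 s2 by metis
  next
    case 4
    define m where "m = length L - j"
    have "(drop j L @ take j L) ! m = a" using 4 jl unfolding m_def by (simp add: nth_append L_def)
    moreover have "(a' # bs' @ ys') ! m \<in> set bs'" 
      using 4 jl 2(3) unfolding m_def by (auto simp: nth_Cons nth_append split: nat.split)
    ultimately have "a \<in> set bs'" using eq by simp
    then show ?thesis using 1 2 by auto
  qed
qed

text \<open>Induction on the given reduction: the diamond pushes the competing step past each of its
  steps. It must merge with one of them, because an irreducible \<open>ys\<close> admits no
  step.\<close>

lemma collapses_after_step:
  "collapses C k xs ys \<Longrightarrow> irreducible_word C k ys \<Longrightarrow> collapse_step C k xs zs \<Longrightarrow> collapses C k zs ys"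
proof (induction arbitrary: zs rule: collapses.induct)
  case (rotation xs i)
  then show ?case by (metis irreducible_word_def irreducible_word_rotate)
next
  case (step xs w ys)
  from collapse_step_diamond[OF step.hyps(1) step.prems(2)]
  show ?case
  proof
    assume "w = zs" then show ?thesis using step by simp
  next
    assume "\<exists>v i. collapse_step C k w v \<and> collapse_step C k zs (rotate i v)"
    then show ?thesis using step.IH step.prems(1) by (meson collapses.step collapses_rotate)
  qed
qed

text \<open>Normal forms are unique only up to rotation, hence the equality of sets.\<close>

lemma normal_form_unique:
  assumes "collapses C k xs ys" "irreducible_word C k ys" "collapses C k xs ys'" "irreducible_word C k ys'"
  shows "set ys = set ys'"
  using assms
proof (induction rule: collapses.induct)
  case (rotation xs i)
  then have "irreducible_word C k xs" by (simp add: irreducible_word_rotate)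
  with rotation(2) show ?case
    by (cases rule: collapses.cases) (auto simp: irreducible_word_def)
next
  case (step xs w ys)
  then show ?case using collapses_after_step by metis
qed

lemma collapse_step_length: "collapse_step C k xs ys \<Longrightarrow> length xs = length ys + Suc k"
  unfolding collapse_step_def by (auto dest: arg_cong[where f = length])

lemma normal_form_exists: "\<exists>ys. collapses C k xs ys \<and> irreducible_word C k ys"
proof (induction xs rule: length_induct)
  case (1 xs)
  show ?case
  proof (cases "irreducible_word C k xs")
    case True
    then show ?thesis using collapses.rotation[of C k xs 0] by auto
  next
    case False
    then obtain zs where zs: "collapse_step C k xs zs" unfolding irreducible_word_def by auto
    then have "length zs < length xs" by (simp add: collapse_step_length)
    with 1 obtain ys where "collapses C k zs ys" "irreducible_word C k ys" by blast
    then show ?thesis using collapses.step[OF zs] by blast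
  qed
qed

section \<open>What a reduction removes\<close>

lemma collapse_step_set:
  assumes "collapse_step C k xs ys" "distinct xs"
  shows "distinct ys" "set ys \<subseteq> set xs" "card (C \<inter> (set xs - set ys)) = 1"
proof -
  from assms(1) obtain i a bs where 1: "rotate i xs = a # bs @ ys" "a \<in> C" "length bs = k" "set bs \<inter> C = {}"
    unfolding collapse_step_def by auto
  have d: "distinct (a # bs @ ys)" using assms(2) 1 by (metis distinct_rotate)
  have s: "set xs = set (a # bs @ ys)" using 1 by (metis set_rotate)
  show "distinct ys" "set ys \<subseteq> set xs" using d s by auto
  have "C \<inter> (set xs - set ys) = {a}" using d s 1 by auto
  then show "card (C \<inter> (set xs - set ys)) = 1" by simp
qed

text \<open>Each step removes \<open>Suc k\<close> letters, exactly one of them in \<open>C\<close>,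
  so the removed letters of \<open>C\<close> count the steps.\<close>

lemma collapses_set:
  assumes "collapses C k xs ys" "distinct xs"
  shows "distinct ys \<and> set ys \<subseteq> set xs \<and> length xs = length ys + Suc k * card (C \<inter> (set xs - set ys))"
  using assms
proof (induction rule: collapses.induct)
  case (step xs w ys)
  note w = collapse_step_set[OF step.hyps(1) step.prems] collapse_step_length[OF step.hyps(1)]
  note IH = step.IH[OF w(1)]
  have "C \<inter> (set xs - set ys) = (C \<inter> (set xs - set w)) \<union> (C \<inter> (set w - set ys))"
    using w IH by auto
  then have "card (C \<inter> (set xs - set ys)) = card (C \<inter> (set xs - set w)) + card (C \<inter> (set w - set ys))"
    by (simp add: card_Un_disjoint disjoint_iff)
  then show ?case using w IH by auto
qed auto

text \<open>A reduction only inspects the letters it removes; membership of the survivors in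
  \<open>C\<close> can be changed freely.\<close>

lemma collapses_cong:
  assumes "collapses C k xs ys" "distinct xs" "\<And>x. x \<in> set xs - set ys \<Longrightarrow> x \<in> C \<longleftrightarrow> x \<in> B"
  shows "collapses B k xs ys"
  using assms
proof (induction rule: collapses.induct)
  case (rotation xs i)
  show ?case by (rule collapses.rotation)
next
  case (step xs w ys)
  note w = collapse_step_set[OF step.hyps(1) step.prems(1)]
  from step.hyps(1) obtain i a bs where 1: "rotate i xs = a # bs @ w" "a \<in> C" "length bs = k" "set bs \<inter> C = {}"
    unfolding collapse_step_def by auto
  have d: "distinct (a # bs @ w)" using step.prems(1) 1 by (metis distinct_rotate)
  have s: "set xs = set (a # bs @ w)" using 1 by (metis set_rotate)
  have sub: "set ys \<subseteq> set w" using collapses_set[OF step.hyps(2) w(1)] by simp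
  have eq: "x \<in> C \<longleftrightarrow> x \<in> B" if "x \<in> set (a # bs)" for x
  proof (rule step.prems(2))
    show "x \<in> set xs - set ys" using that d s sub by auto
  qed
  have "a \<in> B" using eq[of a] 1(2) by simp
  moreover have "set bs \<inter> B = {}" using eq 1(4) by (metis disjoint_iff list.set_intros(2))
  ultimately have "collapse_step B k xs w" unfolding collapse_step_def using 1(1,3) by blast
  moreover have "collapses B k w ys"
    using w(2) by (intro step.IH[OF w(1)] step.prems(2)) blast
  ultimately show ?case by (rule collapses.step)
qed

text \<open>A block reducible for \<open>B\<close> has its last \<open>k\<close> letters outside
  \<open>B\<close>, hence outside \<open>C\<close>. Going backwards around the circle from them, the
  first letter of \<open>C\<close> is followed by at least \<open>k\<close> letters outside
  \<open>C\<close>, so the word is already reducible for \<open>C\<close>.\<close>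

lemma irreducible_word_mono:
  assumes irr: "irreducible_word C k xs" and sub: "C \<inter> set xs \<subseteq> B" and ne: "C \<inter> set xs \<noteq> {}"
  shows "irreducible_word B k xs"
  unfolding irreducible_word_def
proof
  assume "\<exists>ys. collapse_step B k xs ys"
  then obtain zs i a bs where 1: "rotate i xs = a # bs @ zs" "length bs = k" "set bs \<inter> B = {}"
    unfolding collapse_step_def by auto
  have s: "set xs = set (a # bs @ zs)" using 1 by (metis set_rotate)
  have bC: "set bs \<inter> C = {}" using 1 s sub by auto
  \<comment> \<open>\<open>a\<close> need not lie in \<open>C\<close>, so the search for the nearest
    preceding letter of \<open>C\<close> runs through \<open>zs @ [a]\<close>; it succeeds because
    \<open>C\<close> meets the word and avoids \<open>bs\<close>.\<close>
  have "\<exists>c\<in>set (zs @ [a]). c \<in> C" using ne s bC by auto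
  then obtain p c q where pq: "zs @ [a] = p @ c # q" "c \<in> C" "set q \<inter> C = {}"
    using split_list_last_prop[of "zs @ [a]" "\<lambda>c. c \<in> C"] by (metis disjoint_iff)
  define e where "e = q @ bs"
  have e: "length e \<ge> k" "set e \<inter> C = {}" using 1 pq bC unfolding e_def by auto
  have "rotate (Suc k) (rotate i xs) = zs @ a # bs"
    using rotate_append[of "a # bs" zs] 1 by simp
  also have "\<dots> = p @ c # e" using pq(1) unfolding e_def by (metis append.assoc append_Cons append_Nil)
  finally have "rotate (length p) (rotate (Suc k) (rotate i xs)) = c # e @ p"
    by (simp add: rotate_append)
  also have "\<dots> = c # take k e @ (drop k e @ p)" by simp
  finally have "rotate (length p + (Suc k + i)) xs = c # take k e @ (drop k e @ p)"
    by (simp only: rotate_rotate)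
  moreover have "length (take k e) = k" "set (take k e) \<inter> C = {}"
    using e set_take_subset[of k e] by auto
  ultimately have "collapse_step C k xs (drop k e @ p)"
    unfolding collapse_step_def using pq(2) by blast
  then show False using irr unfolding irreducible_word_def by auto
qed

text \<open>Cut the word in front of each letter of \<open>C\<close>. Each piece consists of that
  letter and fewer than \<open>k\<close> further ones, so it has length at most
  \<open>k\<close>.\<close>

lemma length_le_runs:
  assumes "\<And>p a bs q. xs = p @ a # bs @ q \<Longrightarrow> a \<in> C \<Longrightarrow> length bs = k \<Longrightarrow> set bs \<inter> C \<noteq> {}"
    and "xs = [] \<or> hd xs \<in> C"
  shows "length xs \<le> k * length (filter (\<lambda>x. x \<in> C) xs)"
  using assms
proof (induction xs rule: length_induct)
  case (1 xs)
  show ?case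
  proof (cases xs)
    case (Cons c r)
    define t where "t = takeWhile (\<lambda>x. x \<notin> C) r"
    define w where "w = dropWhile (\<lambda>x. x \<notin> C) r"
    have r: "r = t @ w" unfolding t_def w_def by simp
    have tC: "set t \<inter> C = {}" unfolding t_def by (auto dest: set_takeWhileD)
    have c: "c \<in> C" using 1(3) Cons by simp
    have "length t < k"
    proof (rule ccontr)
      assume "\<not> length t < k"
      then have "xs = [] @ c # take k t @ (drop k t @ w)" "length (take k t) = k" using Cons r by simp_all
      then have "set (take k t) \<inter> C \<noteq> {}" using c by (intro 1(2))
      then show False using tC set_take_subset[of k t] by auto
    qed
    moreover have "length w \<le> k * length (filter (\<lambda>x. x \<in> C) w)"
    proof -
      have "length w < length xs" using Cons r by simp
      moreover have "w = [] \<or> hd w \<in> C"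
        using hd_dropWhile[of "\<lambda>x. x \<notin> C" r] unfolding w_def by auto
      moreover have "set bs \<inter> C \<noteq> {}" if "w = p @ a # bs @ q" "a \<in> C" "length bs = k" for p a bs q
      proof (rule 1(2))
        show "xs = (c # t @ p) @ a # bs @ q" using that(1) Cons r by simp
      qed fact+
      ultimately show ?thesis using 1(1)[rule_format, of w] by simp
    qed
    moreover have "filter (\<lambda>x. x \<in> C) xs = c # filter (\<lambda>x. x \<in> C) w"
      using Cons r c tC by (auto simp: filter_empty_conv)
    ultimately show ?thesis using Cons r by simp
  qed simp
qed

lemma irreducible_word_length:
  assumes irr: "irreducible_word C k xs" and ne: "C \<inter> set xs \<noteq> {}" and d: "distinct xs"
  shows "length xs \<le> k * card (C \<inter> set xs)"
proof -
  obtain p c q where pq: "xs = p @ c # q" "c \<in> C" using ne by (metis Int_emptyI split_list)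
  \<comment> \<open>Starting at a letter of \<open>C\<close> leaves no run cut in two by the end of
    the list, so the linear bound applies to the circular word.\<close>
  define L where "L = c # q @ p"
  have L: "L = rotate (length p) xs" unfolding L_def pq by (simp add: rotate_append)
  have "length L \<le> k * length (filter (\<lambda>x. x \<in> C) L)"
  proof (rule length_le_runs)
    fix p' a bs q' assume a: "L = p' @ a # bs @ q'" "a \<in> C" "length bs = k"
    show "set bs \<inter> C \<noteq> {}"
    proof
      assume "set bs \<inter> C = {}"
      moreover have "rotate (length p') L = a # bs @ (q' @ p')" using a by (simp add: rotate_append)
      ultimately have "collapse_step C k L (q' @ p')" unfolding collapse_step_def using a by blast
      then show False using irr L by (metis irreducible_word_def irreducible_word_rotate)
    qed
  qed (use pq L_def in auto)
  moreover have "length (filter (\<lambda>x. x \<in> C) L) = card (C \<inter> set xs)"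
  proof -
    have "distinct L" "set L = set xs" using L d by simp_all
    then have "C \<inter> set xs = set (filter (\<lambda>x. x \<in> C) L)" by auto
    then show ?thesis using \<open>distinct L\<close> by (metis distinct_card distinct_filter)
  qed
  moreover have "length L = length xs" using L by simp
  ultimately show ?thesis by simp
qed

section \<open>The surviving points\<close>

text \<open>\<open>THE\<close> is legitimate by existence and uniqueness of normal forms. For
  \<open>k = 1\<close> these are the unmatched positions of a cyclic bracket word in which the
  points of \<open>C\<close> open.\<close>

definition slots :: "'a set \<Rightarrow> nat \<Rightarrow> 'a list \<Rightarrow> 'a set" where
  "slots C k xs = (THE S. \<exists>ys. collapses C k xs ys \<and> irreducible_word C k ys \<and> S = set ys)"

lemma slots_eqI: "collapses C k xs ys \<Longrightarrow> irreducible_word C k ys \<Longrightarrow> slots C k xs = set ys"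
  unfolding slots_def by (rule the_equality) (auto dest: normal_form_unique)

lemma slots_normal_form:
  obtains ys where "collapses C k xs ys" "irreducible_word C k ys" "slots C k xs = set ys"
  using normal_form_exists slots_eqI by metis

lemma slots_subset: "distinct xs \<Longrightarrow> slots C k xs \<subseteq> set xs"
  using slots_normal_form[of C k xs] collapses_set by metis

lemma card_slots:
  assumes "distinct xs" "C \<subseteq> set xs"
  shows "card (set xs) = card (slots C k xs) + Suc k * card (C - slots C k xs)"
proof -
  obtain ys where ys: "collapses C k xs ys" "slots C k xs = set ys" using slots_normal_form by metis
  have "C \<inter> (set xs - set ys) = C - set ys" using assms by auto
  then show ?thesis using collapses_set[OF ys(1) assms(1)] ys(2) assms(1) by (simp add: distinct_card)
qed

lemma card_slots_le:
  assumes "distinct xs" "C \<inter> slots C k xs \<noteq> {}"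
  shows "card (slots C k xs) \<le> k * card (C \<inter> slots C k xs)"
proof -
  obtain ys where ys: "collapses C k xs ys" "irreducible_word C k ys" "slots C k xs = set ys"
    using slots_normal_form by metis
  have "distinct ys" using collapses_set[OF ys(1) assms(1)] by simp
  then show ?thesis using irreducible_word_length[OF ys(2)] assms(2) ys(3) by (simp add: distinct_card)
qed

text \<open>The old reduction still applies, since \<open>C\<close> is changed only on the
  survivors. Its result stays irreducible: either it has too few letters for a block, or
  \<open>C\<close> meets it and has only been enlarged there.\<close>

lemma slots_update:
  assumes "distinct xs" "U \<subseteq> slots C k xs"
    and "card (slots C k xs) \<le> k \<or> C \<inter> slots C k xs \<noteq> {} \<and> C \<inter> slots C k xs \<subseteq> U"
  shows "slots ((C - slots C k xs) \<union> U) k xs = slots C k xs"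
proof -
  obtain ys where ys: "collapses C k xs ys" "irreducible_word C k ys" "slots C k xs = set ys"
    using slots_normal_form by metis
  let ?B = "(C - set ys) \<union> U"
  have d: "distinct ys" using collapses_set[OF ys(1) assms(1)] by simp
  have "collapses ?B k xs ys"
    using assms(2) ys(3) by (intro collapses_cong[OF ys(1) assms(1)]) auto
  moreover have "irreducible_word ?B k ys"
  proof (cases "card (set ys) \<le> k")
    case True
    then show ?thesis using d unfolding irreducible_word_def
      by (metis collapse_step_length distinct_card le_add2 not_less_eq_eq le_trans)
  next
    case False
    then show ?thesis using ys assms(3) by (intro irreducible_word_mono[OF ys(2)]) auto
  qed
  ultimately show ?thesis using slots_eqI ys(3) by metis
qed

text \<open>Let \<open>S\<close> be the survivors, \<open>e = card (C - S)\<close>,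
  \<open>u = card (C \<inter> S)\<close> and \<open>m = d - e\<close>. Counting all points gives
  \<open>card S = k + (k + 1) * m\<close>, so \<open>e = d\<close> means \<open>card S = k\<close>.
  If \<open>m \<ge> 1\<close>, then \<open>card S \<le> k * u\<close> forces
  \<open>u \<ge> m + 2\<close>, that is \<open>card C \<ge> d + 2\<close>.\<close>

lemma slots_eq_or_large:
  assumes "distinct xs" "C \<subseteq> set xs" "card (set xs) = Suc k * d + k" "d \<le> card C"
  shows "card (slots C k xs) = k \<and> card (C - slots C k xs) = d
    \<or> card (slots C k xs) \<noteq> k \<and> C \<inter> slots C k xs \<noteq> {} \<and> d + 2 \<le> card C \<and>
       (3 \<le> k \<longrightarrow> card C = d + 2 \<longrightarrow> 2 * card (C \<inter> slots C k xs) + 1 \<le> card (slots C k xs))"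
proof -
  define S where "S = slots C k xs"
  define e where "e = card (C - S)"
  define u where "u = card (C \<inter> S)"
  have fin: "finite C" using assms(2) finite_subset by auto
  have eu: "card C = e + u" unfolding e_def u_def using fin by (metis add.commute card_Int_Diff)
  have tot: "Suc k * d + k = card S + Suc k * e"
    using card_slots[OF assms(1,2), of k] assms(3) unfolding S_def e_def by simp
  have "\<not> d < e"
  proof
    assume "d < e"
    then have "Suc k * Suc d \<le> Suc k * e" by (intro mult_le_mono) auto
    then show False using tot by simp
  qed
  then consider "e = d" | "e < d" by linarith
  then show ?thesis
  proof cases
    case 1
    then show ?thesis using tot unfolding S_def[symmetric] e_def[symmetric] by simp
  next
    case 2
    define m where "m = d - e"
    have m: "d = e + m" "m \<ge> 1" using 2 unfolding m_def by auto
    have S: "card S = k + k * m + m" using tot unfolding m(1) by (simp add: algebra_simps)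
    have u: "u \<ge> 1" using assms(4) eu 2 by simp
    then have ne: "C \<inter> S \<noteq> {}" unfolding u_def by auto
    have "card S \<le> k * u" using card_slots_le[OF assms(1)] ne unfolding S_def u_def by simp
    then have ku: "k + k * m + m \<le> k * u" using S by simp
    have um: "m + 2 \<le> u"
    proof (rule ccontr)
      assume "\<not> m + 2 \<le> u"
      then have "k * u \<le> k * (m + 1)" by (intro mult_le_mono) auto
      then show False using ku m by (simp add: algebra_simps)
    qed
    \<comment> \<open>Here \<open>u = m + 2\<close>, so the claim is
      \<open>2 * m + 5 \<le> k + k * m + m\<close>; for \<open>k = 3\<close> and
      \<open>m = 1\<close> it is an equality.\<close>
    have "2 * u + 1 \<le> card S" if "3 \<le> k" "card C = d + 2"
    proof -
      have "u = m + 2" using that eu m by simp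
      moreover have "3 * m \<le> k * m" using that(1) by (rule mult_le_mono1)
      ultimately show ?thesis using S that(1) m(2) by linarith
    qed
    then show ?thesis using S m um eu ne unfolding S_def[symmetric] u_def[symmetric] by auto
  qed
qed

section \<open>Interval partitions\<close>

text \<open>Disjointness and covering are one unique-existence clause. The bound on
  \<open>card A\<close> keeps every interval inside the family of subsets with at least
  \<open>d\<close> elements.\<close>

definition interval_partition :: "'a set \<Rightarrow> nat \<Rightarrow> nat \<Rightarrow> ('a set \<times> 'a set) set \<Rightarrow> bool" where
  "interval_partition X d k P \<longleftrightarrow>
     (\<forall>(A, B) \<in> P. A \<subseteq> B \<and> B \<subseteq> X \<and> d \<le> card A \<and> d + k \<le> card B) \<and>
     (\<forall>C \<subseteq> X. d \<le> card C \<longrightarrow> (\<exists>!I. I \<in> P \<and> fst I \<subseteq> C \<and> C \<subseteq> snd I))"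

section \<open>Reduction to the tight case\<close>

lemma interval_partition_zero: "k \<le> card X \<Longrightarrow> interval_partition X 0 k {({}, X)}"
  unfolding interval_partition_def by auto

lemma interval_partition_trivial: "interval_partition X d 0 {(C, C) |C. C \<subseteq> X \<and> d \<le> card C}"
  unfolding interval_partition_def
proof (intro conjI allI impI)
  fix C assume "C \<subseteq> X" "d \<le> card C"
  then show "\<exists>!I. I \<in> {(C, C) |C. C \<subseteq> X \<and> d \<le> card C} \<and> fst I \<subseteq> C \<and> C \<subseteq> snd I"
    by (intro ex1I[of _ "(C, C)"]) auto
qed auto

text \<open>Split by membership of \<open>x\<close>. Sets without \<open>x\<close> are covered by
  \<open>P\<close>; sets with \<open>x\<close> correspond to subsets of \<open>Y\<close> with at
  least \<open>d\<close> elements, and adding \<open>x\<close> to both ends of an interval raises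
  all sizes by one.\<close>

lemma interval_partition_insert:
  assumes "x \<notin> Y" "finite Y" "interval_partition Y (Suc d) k P" "interval_partition Y d k Q"
  shows "interval_partition (insert x Y) (Suc d) k (P \<union> (\<lambda>(A, B). (insert x A, insert x B)) ` Q)"
  unfolding interval_partition_def
proof (intro conjI ballI allI impI)
  have P: "A \<subseteq> B \<and> B \<subseteq> Y \<and> Suc d \<le> card A \<and> Suc d + k \<le> card B" if "(A, B) \<in> P" for A B
    using assms(3) that unfolding interval_partition_def by auto
  have Q: "A \<subseteq> B \<and> B \<subseteq> Y \<and> d \<le> card A \<and> d + k \<le> card B" if "(A, B) \<in> Q" for A B
    using assms(4) that unfolding interval_partition_def by auto
  let ?h = "\<lambda>(A, B). (insert x A, insert x B)"
  {
    fix I assume I: "I \<in> P \<union> ?h ` Q"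
    show "case I of (A, B) \<Rightarrow> A \<subseteq> B \<and> B \<subseteq> insert x Y \<and> Suc d \<le> card A \<and> Suc d + k \<le> card B"
    proof (cases "I \<in> P")
      case True
      then show ?thesis using P by auto
    next
      case False
      then obtain A B where AB: "I = (insert x A, insert x B)" "(A, B) \<in> Q" using I by auto
      have "finite B" "x \<notin> A" "x \<notin> B" using Q[OF AB(2)] assms(1,2) by (auto intro: finite_subset)
      moreover have "finite A" using Q[OF AB(2)] \<open>finite B\<close> by (auto intro: finite_subset)
      ultimately show ?thesis using Q[OF AB(2)] AB(1) by auto
    qed
  }
  fix C assume C: "C \<subseteq> insert x Y" "Suc d \<le> card C"
  show "\<exists>!I. I \<in> P \<union> ?h ` Q \<and> fst I \<subseteq> C \<and> C \<subseteq> snd I"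
  proof (cases "x \<in> C")
    case False
    then have "C \<subseteq> Y" using C by auto
    then have "\<exists>!I. I \<in> P \<and> fst I \<subseteq> C \<and> C \<subseteq> snd I"
      using assms(3) C unfolding interval_partition_def by auto
    moreover have "I \<in> P \<union> ?h ` Q \<and> fst I \<subseteq> C \<and> C \<subseteq> snd I \<longleftrightarrow> I \<in> P \<and> fst I \<subseteq> C \<and> C \<subseteq> snd I" for I
      using False by auto
    ultimately show ?thesis by simp
  next
    case True
    have "C - {x} \<subseteq> Y" "d \<le> card (C - {x})" using C True by auto
    then have ex1: "\<exists>!I. I \<in> Q \<and> fst I \<subseteq> C - {x} \<and> C - {x} \<subseteq> snd I"
      using assms(4) unfolding interval_partition_def by blast
    then obtain A B where AB: "(A, B) \<in> Q" "A \<subseteq> C - {x}" "C - {x} \<subseteq> B" by auto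
    have uni: "I = (A, B)" if "I \<in> Q" "fst I \<subseteq> C - {x}" "C - {x} \<subseteq> snd I" for I
    proof (rule ex1E[OF ex1])
      fix J assume J: "\<forall>I. I \<in> Q \<and> fst I \<subseteq> C - {x} \<and> C - {x} \<subseteq> snd I \<longrightarrow> I = J"
      have "I = J" using that J by blast
      moreover have "(A, B) = J" using J AB by simp
      ultimately show "I = (A, B)" by simp
    qed
    show ?thesis
    proof (rule ex1I[of _ "?h (A, B)"])
      show "?h (A, B) \<in> P \<union> ?h ` Q \<and> fst (?h (A, B)) \<subseteq> C \<and> C \<subseteq> snd (?h (A, B))"
        using AB True by force
    next
      fix I assume I: "I \<in> P \<union> ?h ` Q \<and> fst I \<subseteq> C \<and> C \<subseteq> snd I"
      have "I \<notin> P" using I True assms(1) P[of "fst I" "snd I"] by auto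
      then obtain A' B' where A'B': "(A', B') \<in> Q" "I = (insert x A', insert x B')" using I by auto
      then have "A' \<subseteq> C - {x}" "C - {x} \<subseteq> B'" using I Q[of A' B'] assms(1) by auto
      then show "I = ?h (A, B)" using uni[of "(A', B')"] A'B' by auto
    qed
  qed
qed

text \<open>Induction on \<open>X\<close>. If the inequality is strict and \<open>d > 0\<close>,
  then after removing a point it still holds for \<open>d\<close> and, a fortiori, for
  \<open>d - 1\<close>, which is the input of \<open>interval_partition_insert\<close>.\<close>

lemma interval_partition_of_tight:
  assumes tight: "\<And>X d. finite X \<Longrightarrow> card (X :: 'a set) = Suc k * d + k \<Longrightarrow> \<exists>P. interval_partition X d k P"
    and "finite (X :: 'a set)" "Suc k * d + k \<le> card X"
  shows "\<exists>P. interval_partition X d k P"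
  using assms(2,3)
proof (induction X arbitrary: d rule: finite_induct)
  case empty
  then show ?case using tight[of "{}" d] by auto
next
  case (insert x Y)
  consider "d = 0" | "Suc k * d + k = card (insert x Y)" | d' where "d = Suc d'" "Suc k * d + k \<le> card Y"
    using insert by (cases d) fastforce+
  then show ?case
  proof cases
    case 1
    then show ?thesis using interval_partition_zero insert.prems by fastforce
  next
    case 2
    then show ?thesis using tight[of "insert x Y" d] insert.hyps by simp
  next
    case 3
    have "Suc k * d' + k \<le> card Y" using 3 by simp
    then obtain P Q where "interval_partition Y d k P" "interval_partition Y d' k Q"
      using insert.IH 3(2) by metis
    then show ?thesis using interval_partition_insert[OF insert.hyps(2,1)] 3(1) by metis
  qed
qed

section \<open>Partitions from surviving points\<close>

text \<open>Sets with exactly \<open>k\<close> survivors \<open>S\<close> form the intervals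
  \<open>[C - S, C \<union> S]\<close>: changing \<open>C\<close> within \<open>S\<close> preserves
  the survivors. So it suffices that \<open>Q\<close> partitions all other sets without touching one
  of these.\<close>

lemma interval_partition_slots:
  assumes xs: "distinct xs" "card (set xs) = Suc k * d + k" and "l \<le> k"
    and Q1: "\<And>A B. (A, B) \<in> Q \<Longrightarrow> A \<subseteq> B \<and> B \<subseteq> set xs \<and> d \<le> card A \<and> d + l \<le> card B"
    and Q2: "\<And>A B C. (A, B) \<in> Q \<Longrightarrow> A \<subseteq> C \<Longrightarrow> C \<subseteq> B \<Longrightarrow> card (slots C k xs) \<noteq> k"
    and Q3: "\<And>C. C \<subseteq> set xs \<Longrightarrow> d \<le> card C \<Longrightarrow> card (slots C k xs) \<noteq> k \<Longrightarrow>
               \<exists>!I. I \<in> Q \<and> fst I \<subseteq> C \<and> C \<subseteq> snd I"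
  shows "\<exists>P. interval_partition (set xs) d l P"
proof -
  let ?S = "\<lambda>C. slots C k xs"
  let ?h = "\<lambda>C. (C - ?S C, C \<union> ?S C)"
  define P where "P = Q \<union> ?h ` {C. C \<subseteq> set xs \<and> card (?S C) = k \<and> card (C - ?S C) = d}"
  have same: "?S B = ?S C" if "card (?S C) = k" "C - ?S C \<subseteq> B" "B \<subseteq> C \<union> ?S C" for B C
  proof -
    have "B = (C - ?S C) \<union> (B \<inter> ?S C)" using that by auto
    then show ?thesis using slots_update[OF xs(1), of "B \<inter> ?S C" C k] that(1) by auto
  qed
  have "interval_partition (set xs) d l P"
    unfolding interval_partition_def
  proof (intro conjI ballI allI impI)
    fix I assume I: "I \<in> P"
    show "case I of (A, B) \<Rightarrow> A \<subseteq> B \<and> B \<subseteq> set xs \<and> d \<le> card A \<and> d + l \<le> card B"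
    proof (cases "I \<in> Q")
      case True
      then show ?thesis using Q1 by auto
    next
      case False
      then obtain C where C: "I = ?h C" "C \<subseteq> set xs" "card (?S C) = k" "card (C - ?S C) = d"
        using I unfolding P_def by auto
      have sub: "?S C \<subseteq> set xs" using slots_subset[OF xs(1)] .
      have "card (C \<union> ?S C) = card (C - ?S C) + card (?S C)"
      proof -
        have "finite C" "finite (?S C)" using C(2) sub by (auto intro: finite_subset)
        then have "card ((C - ?S C) \<union> ?S C) = card (C - ?S C) + card (?S C)"
          by (intro card_Un_disjoint) auto
        then show ?thesis by simp
      qed
      then show ?thesis using C sub assms(3) by auto
    qed
  next
    fix C assume C: "C \<subseteq> set xs" "d \<le> card C"
    show "\<exists>!I. I \<in> P \<and> fst I \<subseteq> C \<and> C \<subseteq> snd I"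
    proof (cases "card (?S C) = k")
      case True
      then have cd: "card (C - ?S C) = d" using slots_eq_or_large[OF xs(1) C(1) xs(2) C(2)] by auto
      show ?thesis
      proof (rule ex1I[of _ "?h C"])
        show "?h C \<in> P \<and> fst (?h C) \<subseteq> C \<and> C \<subseteq> snd (?h C)"
          unfolding P_def using C True cd by auto
      next
        fix I assume I: "I \<in> P \<and> fst I \<subseteq> C \<and> C \<subseteq> snd I"
        have "I \<notin> Q" using Q2[of "fst I" "snd I" C] I True by auto
        then obtain D where D: "I = ?h D" "card (?S D) = k" using I unfolding P_def by auto
        have CD: "D - ?S D \<subseteq> C" "C \<subseteq> D \<union> ?S D" using I D(1) by auto
        have "?S C = ?S D" by (rule same[OF D(2) CD])
        moreover have "C - ?S D = D - ?S D" "C \<union> ?S D = D \<union> ?S D" using CD by auto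
        ultimately show "I = ?h C" using D(1) by simp
      qed
    next
      case False
      have "I \<in> Q" if I: "I \<in> P" "fst I \<subseteq> C" "C \<subseteq> snd I" for I
      proof (rule ccontr)
        assume "I \<notin> Q"
        then obtain D where D: "I = ?h D" "card (?S D) = k" using I unfolding P_def by auto
        then have CD: "D - ?S D \<subseteq> C" "C \<subseteq> D \<union> ?S D" using I by auto
        have "?S C = ?S D" by (rule same[OF D(2) CD])
        then show False using D(2) False by simp
      qed
      then have "I \<in> P \<and> fst I \<subseteq> C \<and> C \<subseteq> snd I \<longleftrightarrow> I \<in> Q \<and> fst I \<subseteq> C \<and> C \<subseteq> snd I" for I
        unfolding P_def by blast
      then show ?thesis using Q3[OF C False] by simp
    qed
  qed
  then show ?thesis by blast
qed

text \<open>Sets with a number of survivors other than \<open>k\<close> have at least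
  \<open>d + 2 \<ge> d + k\<close> elements, so each of them can form an interval by itself.\<close>

lemma interval_partition_exists_le2:
  assumes "finite X" "k \<le> 2" "Suc k * d + k \<le> card X"
  shows "\<exists>P. interval_partition X d k P"
proof (rule interval_partition_of_tight[OF _ assms(1,3)])
  fix X :: "'a set" and d assume X: "finite X" "card X = Suc k * d + k"
  obtain xs where xs: "set xs = X" "distinct xs" using finite_distinct_list[OF X(1)] by auto
  have "\<exists>P. interval_partition (set xs) d k P"
  proof (rule interval_partition_slots[where Q = "{(C, C) |C. C \<subseteq> X \<and> d \<le> card C \<and> card (slots C k xs) \<noteq> k}" and k = k])
    fix A B assume "(A, B) \<in> {(C, C) |C. C \<subseteq> X \<and> d \<le> card C \<and> card (slots C k xs) \<noteq> k}"
    then show "A \<subseteq> B \<and> B \<subseteq> set xs \<and> d \<le> card A \<and> d + k \<le> card B"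
      using slots_eq_or_large[OF xs(2), of A k d] X(2) xs(1) assms(2) by auto
  next
    fix C assume "C \<subseteq> set xs" "d \<le> card C" "card (slots C k xs) \<noteq> k"
    then show "\<exists>!I. I \<in> {(C, C) |C. C \<subseteq> X \<and> d \<le> card C \<and> card (slots C k xs) \<noteq> k} \<and> fst I \<subseteq> C \<and> C \<subseteq> snd I"
      using xs(1) by (intro ex1I[of _ "(C, C)"]) auto
  qed (use xs X in auto)
  then show "\<exists>P. interval_partition X d k P" using xs(1) by simp
qed

text \<open>In an interval partition with \<open>k = 1\<close>, a set of size \<open>u\<close> is
  the bottom of its interval and the top is strictly larger. Any further element of the top serves
  as \<open>g U\<close>, and since \<open>insert (g U) U\<close> stays in the interval of
  \<open>U\<close>, it determines \<open>U\<close>.\<close>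

lemma subset_matching:
  assumes "finite S" "2 * u + 1 \<le> card S"
  shows "\<exists>g. (\<forall>U. U \<subseteq> S \<and> card U = u \<longrightarrow> g U \<in> S - U) \<and>
    inj_on (\<lambda>U. insert (g U) U) {U. U \<subseteq> S \<and> card U = u}"
proof -
  obtain P where P: "interval_partition S u 1 P"
    using interval_partition_exists_le2[OF assms(1), of 1 u] assms(2) by auto
  have "\<exists>x\<in>S - U. \<exists>B. (U, B) \<in> P \<and> x \<in> B" if U: "U \<subseteq> S" "card U = u" for U
  proof -
    obtain A B where AB: "(A, B) \<in> P" "A \<subseteq> U" "U \<subseteq> B"
      using P U unfolding interval_partition_def by (metis order_refl prod.collapse)
    have *: "B \<subseteq> S" "u \<le> card A" "u + 1 \<le> card B" using P AB(1) unfolding interval_partition_def by auto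
    have "finite U" "finite B" using U *(1) assms(1) finite_subset by auto
    then have "A = U" using AB U * by (simp add: card_seteq)
    moreover have "\<not> B \<subseteq> U" using *(3) U(2) card_mono[OF \<open>finite U\<close>, of B] by auto
    ultimately show ?thesis using AB *(1) by auto
  qed
  then obtain g where g: "\<And>U. U \<subseteq> S \<Longrightarrow> card U = u \<Longrightarrow> g U \<in> S - U \<and> (\<exists>B. (U, B) \<in> P \<and> g U \<in> B)"
    by metis
  have "inj_on (\<lambda>U. insert (g U) U) {U. U \<subseteq> S \<and> card U = u}"
  proof (rule inj_onI, clarify)
    fix U V assume U: "U \<subseteq> S" "u = card U" and V: "V \<subseteq> S" "card V = card U"
      and eq: "insert (g U) U = insert (g V) V"
    define W where "W = insert (g U) U"
    obtain B where B: "(U, B) \<in> P" "g U \<in> B" using g[of U] U by auto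
    obtain B' where B': "(V, B') \<in> P" "g V \<in> B'" using g[of V] U V by auto
    have sub: "U \<subseteq> B" "V \<subseteq> B'" using P B B' unfolding interval_partition_def by auto
    have W: "W \<subseteq> S" "u \<le> card W"
      using U g[of U] assms(1) finite_subset[OF U(1)] unfolding W_def by (auto simp: card_insert_if)
    have 1: "fst (U, B) \<subseteq> W \<and> W \<subseteq> snd (U, B)" using B sub unfolding W_def by auto
    have 2: "fst (V, B') \<subseteq> W \<and> W \<subseteq> snd (V, B')" using B' sub unfolding W_def eq by auto
    have "\<exists>!I. I \<in> P \<and> fst I \<subseteq> W \<and> W \<subseteq> snd I" using P W unfolding interval_partition_def by simp
    then have "(U, B) = (V, B')" using 1 2 B(1) B'(1) by (metis (no_types, lifting))
    then show "U = V" by simp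
  qed
  then show ?thesis using g by blast
qed

text \<open>Among the sets whose number of survivors is not 3, only those of size
  \<open>d + 2\<close> are too small to be intervals by themselves. Each is joined with a superset
  of size \<open>d + 3\<close> having the same survivors; the added point comes from
  \<open>subset_matching\<close> applied to the survivors.\<close>

lemma interval_partition_exists_3:
  assumes "finite X" "4 * d + 3 \<le> card X"
  shows "\<exists>P. interval_partition X d 3 P"
proof (rule interval_partition_of_tight[OF _ assms(1)])
  show "Suc 3 * d + 3 \<le> card X" using assms(2) by simp
next
  fix X :: "'a set" and d assume X: "finite X" "card X = Suc 3 * d + 3"
  obtain xs where xs: "set xs = X" "distinct xs" using finite_distinct_list[OF X(1)] by auto
  let ?S = "\<lambda>C. slots C 3 xs"
  \<comment> \<open>One function is chosen for each \<open>S\<close> and \<open>u\<close>, so that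
    sets with equal survivors use the same matching; injectivity of \<open>\<psi>\<close> below
    depends on this.\<close>
  obtain g where g: "\<And>S u U. finite S \<Longrightarrow> 2 * u + 1 \<le> card S \<Longrightarrow> U \<subseteq> S \<Longrightarrow> card U = u \<Longrightarrow> g S u U \<in> S - U"
    and inj: "\<And>S u. finite S \<Longrightarrow> 2 * u + 1 \<le> card S \<Longrightarrow>
      inj_on (\<lambda>U. insert (g S u U) U) {U. U \<subseteq> (S :: 'a set) \<and> card U = u}"
  proof -
    have "\<forall>S u. \<exists>g. finite S \<longrightarrow> 2 * u + 1 \<le> card S \<longrightarrow>
      (\<forall>U. U \<subseteq> (S :: 'a set) \<and> card U = u \<longrightarrow> g U \<in> S - U) \<and>
      inj_on (\<lambda>U. insert (g U) U) {U. U \<subseteq> S \<and> card U = u}"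
      using subset_matching by blast
    then obtain g where "\<And>S u. finite S \<Longrightarrow> 2 * u + 1 \<le> card S \<Longrightarrow>
      (\<forall>U. U \<subseteq> (S :: 'a set) \<and> card U = u \<longrightarrow> g S u U \<in> S - U) \<and>
      inj_on (\<lambda>U. insert (g S u U) U) {U. U \<subseteq> S \<and> card U = u}"
      unfolding choice_iff by blast
    then show thesis using that[of g] by blast
  qed
  define R where "R = {C. C \<subseteq> X \<and> d \<le> card C \<and> card (?S C) \<noteq> 3}"
  define R2 where "R2 = {C \<in> R. card C = d + 2}"
  define \<psi> where "\<psi> C = insert (g (?S C) (card (C \<inter> ?S C)) (C \<inter> ?S C)) C" for C
  have fin: "finite (?S C)" for C using slots_subset[OF xs(2), of C 3] by (rule finite_subset) simp
  have R: "d + 2 \<le> card C" "C \<inter> ?S C \<noteq> {}" if "C \<in> R" for C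
    using that slots_eq_or_large[OF xs(2), of C 3 d] X(2) xs(1) unfolding R_def by auto
  have R2: "2 * card (C \<inter> ?S C) + 1 \<le> card (?S C)" if "C \<in> R2" for C
    using that slots_eq_or_large[OF xs(2), of C 3 d] X(2) xs(1) unfolding R_def R2_def by auto
  have gR2: "g (?S C) (card (C \<inter> ?S C)) (C \<inter> ?S C) \<in> ?S C - C" if "C \<in> R2" for C
    using g[OF fin R2[OF that], of "C \<inter> ?S C"] by auto
  have \<psi>S: "?S (\<psi> C) = ?S C" if "C \<in> R2" for C
  proof -
    have eq: "(C - ?S C) \<union> (\<psi> C \<inter> ?S C) = \<psi> C" using gR2[OF that] unfolding \<psi>_def by auto
    have "C \<inter> ?S C \<subseteq> \<psi> C \<inter> ?S C" unfolding \<psi>_def by auto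
    moreover have "C \<inter> ?S C \<noteq> {}" using R(2)[of C] that unfolding R2_def by simp
    ultimately have "?S ((C - ?S C) \<union> (\<psi> C \<inter> ?S C)) = ?S C"
      by (intro slots_update[OF xs(2)]) simp_all
    then show ?thesis by (simp only: eq)
  qed
  have \<psi>card: "card (\<psi> C) = d + 3" "\<psi> C \<in> R" if "C \<in> R2" for C
  proof -
    have C: "C \<subseteq> X" "card C = d + 2" using that unfolding R2_def R_def by auto
    have "finite C" using C(1) X(1) by (rule finite_subset)
    then show c: "card (\<psi> C) = d + 3" using gR2[OF that] C unfolding \<psi>_def by simp
    have "\<psi> C \<subseteq> X" using gR2[OF that] C slots_subset[OF xs(2), of C 3] xs(1) unfolding \<psi>_def by auto
    then show "\<psi> C \<in> R" using \<psi>S[OF that] that c unfolding R2_def R_def by simp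
  qed
  \<comment> \<open>\<open>\<psi> C\<close> determines \<open>C\<close>: it has the same survivors
    and the same points outside them. Hence \<open>card (C \<inter> ?S C)\<close> is known as well,
    and the matching for this size is injective.\<close>
  have \<psi>inj: "C = D" if CD: "C \<in> R2" "D \<in> R2" "\<psi> C = \<psi> D" for C D
  proof -
    have S: "?S C = ?S D" using \<psi>S CD by metis
    have "C - ?S C = \<psi> C - ?S C" using gR2[OF CD(1)] unfolding \<psi>_def by auto
    moreover have "D - ?S D = \<psi> D - ?S D" using gR2[OF CD(2)] unfolding \<psi>_def by auto
    ultimately have out: "C - ?S C = D - ?S C" using S CD(3) by simp
    have "C \<subseteq> X" "D \<subseteq> X" and cardCD: "card C = card D" using CD unfolding R2_def R_def by auto
    then have fC: "finite C" "finite D" using X(1) by (auto intro: finite_subset)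
    have card: "card (C \<inter> ?S C) = card (D \<inter> ?S C)"
      using card_Int_Diff[OF fC(1), of "?S C"] card_Int_Diff[OF fC(2), of "?S C"] out cardCD by simp
    define u where "u = card (C \<inter> ?S C)"
    have uD: "card (D \<inter> ?S D) = u" using card S unfolding u_def by simp
    have "\<psi> C \<inter> ?S C = insert (g (?S C) u (C \<inter> ?S C)) (C \<inter> ?S C)"
      using gR2[OF CD(1)] unfolding \<psi>_def u_def by auto
    moreover have "\<psi> D \<inter> ?S C = insert (g (?S C) u (D \<inter> ?S C)) (D \<inter> ?S C)"
      using gR2[OF CD(2)] uD S unfolding \<psi>_def by auto
    ultimately have eq: "insert (g (?S C) u (C \<inter> ?S C)) (C \<inter> ?S C) = insert (g (?S C) u (D \<inter> ?S C)) (D \<inter> ?S C)"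
      using CD(3) by simp
    have "inj_on (\<lambda>U. insert (g (?S C) u U) U) {U. U \<subseteq> ?S C \<and> card U = u}"
      using inj[OF fin] R2[OF CD(1)] unfolding u_def by auto
    then have "C \<inter> ?S C = D \<inter> ?S C"
      using eq by (rule inj_onD) (use card in \<open>simp_all add: u_def\<close>)
    then show ?thesis using out by blast
  qed
  \<comment> \<open>Sets hit by \<open>\<psi>\<close> are already tops of two-element intervals and
    must not occur again as singletons.\<close>
  define Q where "Q = {(C, \<psi> C) |C. C \<in> R2} \<union> {(C, C) |C. C \<in> R - R2 - \<psi> ` R2}"
  have sub\<psi>: "C \<subseteq> \<psi> C" for C unfolding \<psi>_def by auto
  have between: "C = A \<or> C = \<psi> A" if "A \<subseteq> C" "C \<subseteq> \<psi> A" for A C using that unfolding \<psi>_def by auto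
  have "\<exists>P. interval_partition (set xs) d 3 P"
  proof (rule interval_partition_slots[where Q = Q and k = 3])
    show "A \<subseteq> B \<and> B \<subseteq> set xs \<and> d \<le> card A \<and> d + 3 \<le> card B" if AB: "(A, B) \<in> Q" for A B
    proof -
      consider "A \<in> R2" "B = \<psi> A" | "B = A" "A \<in> R" "A \<notin> R2" using AB unfolding Q_def by auto
      then show ?thesis
      proof cases
        case 1
        then show ?thesis using \<psi>card[of A] sub\<psi>[of A] xs(1) unfolding R_def R2_def by auto
      next
        case 2
        then show ?thesis using R(1)[of A] xs(1) unfolding R_def R2_def by auto
      qed
    qed
  next
    fix A B C assume AB: "(A, B) \<in> Q" "A \<subseteq> C" "C \<subseteq> B"
    then have "C \<in> R" using between[of A C] \<psi>card(2) unfolding Q_def R2_def by auto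
    then show "card (?S C) \<noteq> 3" unfolding R_def by simp
  next
    fix C assume "C \<subseteq> set xs" "d \<le> card C" "card (?S C) \<noteq> 3"
    then have C: "C \<in> R" using xs(1) unfolding R_def by simp
    have disj: "D \<notin> R2" if D: "D \<in> \<psi> ` R2" for D
    proof -
      obtain E where "E \<in> R2" "D = \<psi> E" using D by auto
      then show ?thesis using \<psi>card(1)[of E] unfolding R2_def by simp
    qed
    have Q: "I \<in> Q \<and> fst I \<subseteq> C \<and> C \<subseteq> snd I \<longleftrightarrow>
      (\<exists>D\<in>R2. I = (D, \<psi> D) \<and> (C = D \<or> C = \<psi> D)) \<or> (C \<notin> R2 \<and> C \<notin> \<psi> ` R2 \<and> I = (C, C))"
      (is "?l \<longleftrightarrow> ?r") for I
    proof
      assume I: ?l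
      then have "I \<in> Q" by simp
      then consider D where "D \<in> R2" "I = (D, \<psi> D)" | D where "D \<in> R - R2 - \<psi> ` R2" "I = (D, D)"
        unfolding Q_def by auto
      then show ?r
      proof cases
        case 1
        then have "C = D \<or> C = \<psi> D" using I by (intro between) simp_all
        with 1 show ?thesis by blast
      next
        case 2
        then have "D = C" using I by auto
        with 2 show ?thesis by blast
      qed
    next
      assume ?r
      then show ?l
      proof
        assume "\<exists>D\<in>R2. I = (D, \<psi> D) \<and> (C = D \<or> C = \<psi> D)"
        then obtain D where "D \<in> R2" "I = (D, \<psi> D)" "C = D \<or> C = \<psi> D" by blast
        then have "I \<in> Q" "fst I = D" "snd I = \<psi> D" unfolding Q_def by auto
        with \<open>C = D \<or> C = \<psi> D\<close> show ?l using sub\<psi>[of D] by auto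
      next
        assume "C \<notin> R2 \<and> C \<notin> \<psi> ` R2 \<and> I = (C, C)"
        moreover from this have "I \<in> Q" using C unfolding Q_def by blast
        ultimately show ?l by simp
      qed
    qed
    consider "C \<in> R2" | D where "D \<in> R2" "C = \<psi> D" | "C \<notin> R2" "C \<notin> \<psi> ` R2" by auto
    then show "\<exists>!I. I \<in> Q \<and> fst I \<subseteq> C \<and> C \<subseteq> snd I"
    proof cases
      case 1
      show ?thesis
      proof (rule ex1I[of _ "(C, \<psi> C)"])
        show "(C, \<psi> C) \<in> Q \<and> fst (C, \<psi> C) \<subseteq> C \<and> C \<subseteq> snd (C, \<psi> C)"
          unfolding Q using 1 by blast
        show "I = (C, \<psi> C)" if "I \<in> Q \<and> fst I \<subseteq> C \<and> C \<subseteq> snd I" for I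
          using that 1 disj[of C] unfolding Q by blast
      qed
    next
      case 2
      show ?thesis
      proof (rule ex1I[of _ "(D, \<psi> D)"])
        show "(D, \<psi> D) \<in> Q \<and> fst (D, \<psi> D) \<subseteq> C \<and> C \<subseteq> snd (D, \<psi> D)"
          unfolding Q by (intro disjI1 bexI[of _ D]) (simp_all add: 2)
        have "C \<in> \<psi> ` R2" using 2(1) unfolding 2(2) by (rule imageI)
        fix I assume "I \<in> Q \<and> fst I \<subseteq> C \<and> C \<subseteq> snd I"
        then obtain E where E: "E \<in> R2" "I = (E, \<psi> E)" "C = E \<or> C = \<psi> E"
          unfolding Q using \<open>C \<in> \<psi> ` R2\<close> by blast
        have "C \<noteq> E" using disj[OF \<open>C \<in> \<psi> ` R2\<close>] E(1) by blast
        then have "\<psi> E = \<psi> D" using E(3) 2(2) by simp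
        then show "I = (D, \<psi> D)" using \<psi>inj[OF E(1) 2(1)] E(2) by simp
      qed
    next
      case 3
      show ?thesis
      proof (rule ex1I[of _ "(C, C)"])
        show "(C, C) \<in> Q \<and> fst (C, C) \<subseteq> C \<and> C \<subseteq> snd (C, C)"
          unfolding Q using 3 by blast
        show "I = (C, C)" if "I \<in> Q \<and> fst I \<subseteq> C \<and> C \<subseteq> snd I" for I
          using that 3 unfolding Q by auto
      qed
    qed
  qed (use xs X in auto)
  then show "\<exists>P. interval_partition X d 3 P" using xs(1) by simp
qed

section \<open>Monomial Stanley decompositions\<close>

lemma poly_mapping_eq_sum_single:
  "(p :: 'a \<Rightarrow>\<^sub>0 'b::comm_monoid_add) = (\<Sum>m\<in>Poly_Mapping.keys p. Poly_Mapping.single m (Poly_Mapping.lookup p m))"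
  by (rule poly_mapping_eqI)
    (simp add: lookup_sum lookup_single when_def sum.delta in_keys_iff)

lemma keys_add_nat: "Poly_Mapping.keys (a + b :: 'n \<Rightarrow>\<^sub>0 nat) = Poly_Mapping.keys a \<union> Poly_Mapping.keys b"
  by (auto simp: in_keys_iff lookup_add)

lemma lookup_mult_monomial:
  "Poly_Mapping.lookup (p * Poly_Mapping.single a c) (a + b) =
    Poly_Mapping.lookup (p :: ('n, 'k::comm_semiring_1) mpoly) b * c"
proof -
  have "(Poly_Mapping.lookup (Poly_Mapping.single a c) q when a + b = l + q) = ((c when l = b) when a = q)" for l q
    by (auto simp: lookup_single when_def add.commute)
  then show ?thesis by (simp add: lookup_mult mult_when)
qed

lemma keys_mult_monomial:
  "Poly_Mapping.keys (p * Poly_Mapping.single a c) \<subseteq> (+) a ` Poly_Mapping.keys (p :: ('n, 'k::comm_semiring_1) mpoly)"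
  using keys_mult[of p "Poly_Mapping.single a c"] by (auto split: if_splits simp: add.commute)

text \<open>A polynomial is determined by its coefficients, so for subspaces spanned by monomials a
  direct sum amounts to a partition of the exponents.\<close>

lemma direct_sum_decomp_keys:
  fixes T :: "nat \<Rightarrow> 'a set"
  shows "direct_sum_decomp r (\<lambda>i. {p :: 'a \<Rightarrow>\<^sub>0 'k::{comm_monoid_add,zero_neq_one}. Poly_Mapping.keys p \<subseteq> T i})
      {p. Poly_Mapping.keys p \<subseteq> U} \<longleftrightarrow> (\<Union>i<r. T i) = U \<and> disjoint_family_on T {..<r}"
    (is "?l \<longleftrightarrow> ?r")
proof
  let ?V = "\<lambda>i. {p :: 'a \<Rightarrow>\<^sub>0 'k. Poly_Mapping.keys p \<subseteq> T i}"
  let ?x = "\<lambda>m. Poly_Mapping.single m (1 :: 'k)"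
  \<comment> \<open>\<open>e i m\<close> has the monomial with exponent \<open>m\<close> in
    component \<open>i\<close> and zero elsewhere; the restriction to \<open>{..<r}\<close> puts it
    in the extensional product.\<close>
  define e where "e i m = (\<lambda>j::nat\<in>{..<r}. if j = i then ?x m else 0)" for i and m :: 'a
  assume l: ?l
  have inj: "inj_on (\<lambda>v. \<Sum>i<r. v i) (Pi\<^sub>E {..<r} ?V)"
    and img: "(\<lambda>v. \<Sum>i<r. v i) ` (Pi\<^sub>E {..<r} ?V) = {p. Poly_Mapping.keys p \<subseteq> U}"
    using l unfolding direct_sum_decomp_def bij_betw_def by auto
  have e: "e i m \<in> Pi\<^sub>E {..<r} ?V" "(\<Sum>j<r. e i m j) = ?x m" if "i < r" "m \<in> T i" for i m
  proof -
    show "e i m \<in> Pi\<^sub>E {..<r} ?V" unfolding e_def using that by (auto split: if_splits)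
    have "(\<Sum>j<r. e i m j) = (\<Sum>j<r. if j = i then ?x m else 0)" unfolding e_def by simp
    also have "\<dots> = ?x m" using that by simp
    finally show "(\<Sum>j<r. e i m j) = ?x m" .
  qed
  show ?r
  proof (intro conjI subset_antisym subsetI)
    fix m assume "m \<in> (\<Union>i<r. T i)"
    then obtain i where "i < r" "m \<in> T i" by auto
    then have "?x m \<in> (\<lambda>v. \<Sum>i<r. v i) ` (Pi\<^sub>E {..<r} ?V)"
      using e[of i m] by (intro image_eqI[where x = "e i m"]) simp_all
    then show "m \<in> U" unfolding img by simp
  next
    fix m assume "m \<in> U"
    then have "?x m \<in> (\<lambda>v. \<Sum>i<r. v i) ` (Pi\<^sub>E {..<r} ?V)" unfolding img by simp
    then obtain v where v: "v \<in> Pi\<^sub>E {..<r} ?V" "?x m = (\<Sum>i<r. v i)" by auto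
    have "(\<Sum>i<r. Poly_Mapping.lookup (v i) m) \<noteq> 0"
      using arg_cong[OF v(2), of "\<lambda>p. Poly_Mapping.lookup p m"] by (simp add: lookup_sum)
    then obtain i where "i < r" "Poly_Mapping.lookup (v i) m \<noteq> 0"
      by (meson lessThan_iff sum.not_neutral_contains_not_neutral)
    moreover from this v(1) have "Poly_Mapping.keys (v i) \<subseteq> T i" by auto
    ultimately show "m \<in> (\<Union>i<r. T i)" by (auto simp: in_keys_iff)
  next
    show "disjoint_family_on T {..<r}"
    proof (rule ccontr)
      assume "\<not> disjoint_family_on T {..<r}"
      then obtain i j m where ij: "i < r" "j < r" "i \<noteq> j" "m \<in> T i" "m \<in> T j"
        unfolding disjoint_family_on_def by auto
      \<comment> \<open>Both families add up to the monomial with exponent \<open>m\<close>, so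
        injectivity identifies them although they differ in component \<open>i\<close>.\<close>
      have "e i m = e j m" by (rule inj_onD[OF inj]) (use e ij in auto)
      then have "e i m i = e j m i" by simp
      then show False unfolding e_def using ij by (simp split: if_splits)
        (metis lookup_single_eq lookup_zero zero_neq_one)
    qed
  qed
next
  let ?V = "\<lambda>i. {p :: 'a \<Rightarrow>\<^sub>0 'k. Poly_Mapping.keys p \<subseteq> T i}"
  assume r: ?r
  have outside: "Poly_Mapping.lookup (v i) m = 0" if "v \<in> Pi\<^sub>E {..<r} ?V" "i < r" "m \<notin> T i" for v i m
  proof -
    have "Poly_Mapping.keys (v i) \<subseteq> T i" using PiE_mem[OF that(1), of i] that(2) by simp
    then show ?thesis using that(3) by (auto simp: in_keys_iff)
  qed
  have inside: "Poly_Mapping.lookup (\<Sum>j<r. v j) m = Poly_Mapping.lookup (v i) m"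
    if v: "v \<in> Pi\<^sub>E {..<r} ?V" "i < r" "m \<in> T i" for v i m
  proof -
    have "m \<notin> T j" if "j < r" "j \<noteq> i" for j
      using r v that unfolding disjoint_family_on_def by auto
    then have "(\<Sum>j<r. Poly_Mapping.lookup (v j) m) = (\<Sum>j<r. if j = i then Poly_Mapping.lookup (v i) m else 0)"
      using outside[OF v(1)] by (intro sum.cong) auto
    then show ?thesis using v by (simp add: lookup_sum)
  qed
  show ?l
    unfolding direct_sum_decomp_def
  proof (rule bij_betwI')
    fix v w assume v: "v \<in> Pi\<^sub>E {..<r} ?V" and w: "w \<in> Pi\<^sub>E {..<r} ?V"
    show "((\<Sum>i<r. v i) = (\<Sum>i<r. w i)) = (v = w)"
    proof
      assume eq: "(\<Sum>i<r. v i) = (\<Sum>i<r. w i)"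
      show "v = w"
      proof (rule PiE_ext[OF v w])
        fix i assume i: "i \<in> {..<r}"
        show "v i = w i"
        proof (rule poly_mapping_eqI)
          fix m show "Poly_Mapping.lookup (v i) m = Poly_Mapping.lookup (w i) m"
            using inside[OF v, of i m] inside[OF w, of i m] outside[OF v, of i m] outside[OF w, of i m] i eq
            by (cases "m \<in> T i") auto
        qed
      qed
    qed simp
  next
    fix v assume v: "v \<in> Pi\<^sub>E {..<r} ?V"
    have "m \<in> U" if m: "m \<in> Poly_Mapping.keys (\<Sum>i<r. v i)" for m
    proof -
      have "(\<Sum>i<r. Poly_Mapping.lookup (v i) m) \<noteq> 0" using m by (simp add: in_keys_iff lookup_sum)
      then obtain i where "i < r" "Poly_Mapping.lookup (v i) m \<noteq> 0"
        by (meson lessThan_iff sum.not_neutral_contains_not_neutral)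
      then show ?thesis using r outside[OF v] by blast
    qed
    then show "(\<Sum>i<r. v i) \<in> {p. Poly_Mapping.keys p \<subseteq> U}" by auto
  next
    fix p :: "'a \<Rightarrow>\<^sub>0 'k" assume p: "p \<in> {p. Poly_Mapping.keys p \<subseteq> U}"
    define v where "v = (\<lambda>i\<in>{..<r}. Abs_poly_mapping (\<lambda>m. Poly_Mapping.lookup p m when m \<in> T i))"
    have look: "Poly_Mapping.lookup (v i) m = (Poly_Mapping.lookup p m when m \<in> T i)" if "i < r" for i m
    proof -
      have "finite {m. (Poly_Mapping.lookup p m when m \<in> T i) \<noteq> 0}"
        by (rule finite_subset[OF _ finite_lookup[of p]]) auto
      then show ?thesis unfolding v_def using that by simp
    qed
    have v: "v \<in> Pi\<^sub>E {..<r} ?V"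
    proof (rule PiE_I)
      show "v i \<in> ?V i" if "i \<in> {..<r}" for i using look that by (auto simp: in_keys_iff)
    qed (simp add: v_def)
    moreover have "p = (\<Sum>i<r. v i)"
    proof (rule poly_mapping_eqI)
      fix m
      show "Poly_Mapping.lookup p m = Poly_Mapping.lookup (\<Sum>i<r. v i) m"
      proof (cases "m \<in> U")
        case True
        then obtain i where "i < r" "m \<in> T i" using r by auto
        then show ?thesis using inside[OF v] look by simp
      next
        case False
        then have "Poly_Mapping.lookup p m = 0" using p by (auto simp: in_keys_iff)
        then show ?thesis using look by (simp add: lookup_sum)
      qed
    qed
    ultimately show "\<exists>v\<in>Pi\<^sub>E {..<r} ?V. p = (\<Sum>i<r. v i)" by blast
  qed
qed

text \<open>The exponents of the monomials in \<open>x^a K[Z]\<close>.\<close>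

definition monomial_cone :: "('n \<Rightarrow>\<^sub>0 nat) \<Rightarrow> 'n set \<Rightarrow> ('n \<Rightarrow>\<^sub>0 nat) set" where
  "monomial_cone a Z = {a + b |b. Poly_Mapping.keys b \<subseteq> Z}"

lemma stanley_space_monomial:
  assumes "(c :: 'k::field) \<noteq> 0"
  shows "stanley_space (*) (Poly_Mapping.single a c) Z = {p :: ('n, 'k) mpoly. Poly_Mapping.keys p \<subseteq> monomial_cone a Z}"
proof (intro subset_antisym subsetI)
  fix p :: "('n, 'k) mpoly" assume "p \<in> stanley_space (*) (Poly_Mapping.single a c) Z"
  then obtain q where "p = q * Poly_Mapping.single a c" "q \<in> K[Z]"
    unfolding stanley_space_def by auto
  then show "p \<in> {p. Poly_Mapping.keys p \<subseteq> monomial_cone a Z}"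
    using keys_mult_monomial[of q a c] unfolding poly_subring_def monomial_cone_def by blast
next
  fix p :: "('n, 'k) mpoly" assume p: "p \<in> {p. Poly_Mapping.keys p \<subseteq> monomial_cone a Z}"
  \<comment> \<open>\<open>p\<close> is divided by the monomial term by term; the truncated
    difference \<open>m - a\<close> is exact, because \<open>m\<close> lies in the cone.\<close>
  define q where "q = (\<Sum>m\<in>Poly_Mapping.keys p. Poly_Mapping.single (m - a) (Poly_Mapping.lookup p m / c))"
  have keys: "\<exists>b. m = a + b \<and> Poly_Mapping.keys b \<subseteq> Z" if "m \<in> Poly_Mapping.keys p" for m
    using p that unfolding monomial_cone_def by auto
  have "q * Poly_Mapping.single a c = (\<Sum>m\<in>Poly_Mapping.keys p. Poly_Mapping.single m (Poly_Mapping.lookup p m))"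
    unfolding q_def sum_distrib_right
  proof (rule sum.cong[OF refl])
    fix m assume "m \<in> Poly_Mapping.keys p"
    from keys[OF this] show "Poly_Mapping.single (m - a) (Poly_Mapping.lookup p m / c) * Poly_Mapping.single a c =
        Poly_Mapping.single m (Poly_Mapping.lookup p m)"
      using assms by (auto simp: mult_single add.commute)
  qed
  then have "q * Poly_Mapping.single a c = p" by (simp flip: poly_mapping_eq_sum_single)
  moreover have "q \<in> K[Z]"
    unfolding poly_subring_def
  proof (intro CollectI ballI)
    fix l assume "l \<in> Poly_Mapping.keys q"
    then have "(\<Sum>m\<in>Poly_Mapping.keys p. Poly_Mapping.lookup (Poly_Mapping.single (m - a) (Poly_Mapping.lookup p m / c)) l) \<noteq> 0"
      unfolding q_def by (simp add: in_keys_iff lookup_sum)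
    then obtain m where m: "m \<in> Poly_Mapping.keys p"
      "Poly_Mapping.lookup (Poly_Mapping.single (m - a) (Poly_Mapping.lookup p m / c)) l \<noteq> 0"
      by (meson sum.not_neutral_contains_not_neutral)
    then have "l = m - a" by (auto simp: lookup_single)
    then show "Poly_Mapping.keys l \<subseteq> Z" using keys[OF m(1)] by auto
  qed
  ultimately show "p \<in> stanley_space (*) (Poly_Mapping.single a c) Z"
    unfolding stanley_space_def by (metis imageI)
qed

lemma inj_mult_monomial:
  assumes "(c :: 'k::field) \<noteq> 0"
  shows "inj (\<lambda>p :: ('n, 'k) mpoly. p * Poly_Mapping.single a c)"
proof (rule injI)
  fix p q :: "('n, 'k) mpoly" assume eq: "p * Poly_Mapping.single a c = q * Poly_Mapping.single a c"
  show "p = q"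
  proof (rule poly_mapping_eqI)
    fix b show "Poly_Mapping.lookup p b = Poly_Mapping.lookup q b"
      using arg_cong[OF eq, of "\<lambda>p. Poly_Mapping.lookup p (a + b)"] assms by (simp add: lookup_mult_monomial)
  qed
qed

lemma homogeneous_eq_monomial:
  fixes u :: "('n, 'k::zero) mpoly"
  assumes "u \<in> mpoly_grading \<alpha>" "u \<noteq> 0"
  obtains a c where "u = Poly_Mapping.single a c" "c \<noteq> 0"
proof -
  have "\<exists>a. a \<in> Poly_Mapping.keys u"
  proof (rule ccontr)
    assume "\<nexists>a. a \<in> Poly_Mapping.keys u"
    then have "u = 0" by (intro poly_mapping_eqI) (auto simp: in_keys_iff)
    then show False using assms(2) by simp
  qed
  then obtain a where a: "a \<in> Poly_Mapping.keys u" by auto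
  have "m = a" if "m \<in> Poly_Mapping.keys u" for m
  proof (rule poly_mapping_eqI)
    fix i
    have "int (Poly_Mapping.lookup m i) = \<alpha> i" "int (Poly_Mapping.lookup a i) = \<alpha> i"
      using assms(1) a that unfolding mpoly_grading_def by auto
    then show "Poly_Mapping.lookup m i = Poly_Mapping.lookup a i" by simp
  qed
  then have "u = Poly_Mapping.single a (Poly_Mapping.lookup u a)"
    by (intro poly_mapping_eqI) (auto simp: lookup_single when_def in_keys_iff)
  then show thesis using that a by (metis in_keys_iff)
qed

section \<open>Squarefree monomials and the Veronese ideal\<close>

definition indicator_exponent :: "'n::finite set \<Rightarrow> 'n \<Rightarrow>\<^sub>0 nat" where
  "indicator_exponent A = Abs_poly_mapping (\<lambda>i. if i \<in> A then 1 else 0)"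

lemma lookup_indicator_exponent: "Poly_Mapping.lookup (indicator_exponent A) i = (if i \<in> A then 1 else 0)"
  unfolding indicator_exponent_def by simp

lemma keys_indicator_exponent [simp]: "Poly_Mapping.keys (indicator_exponent A) = A"
  by (auto simp: in_keys_iff lookup_indicator_exponent split: if_splits)

text \<open>The link between intervals and Stanley spaces: whether an exponent lies in the cone
  depends on its support alone, which has to belong to \<open>[A, B]\<close>.\<close>

lemma monomial_cone_indicator:
  assumes "A \<subseteq> B"
  shows "monomial_cone (indicator_exponent A) B = {m. A \<subseteq> Poly_Mapping.keys m \<and> Poly_Mapping.keys m \<subseteq> B}"
proof (intro subset_antisym subsetI)
  fix m :: "'a \<Rightarrow>\<^sub>0 nat" assume m: "m \<in> {m. A \<subseteq> Poly_Mapping.keys m \<and> Poly_Mapping.keys m \<subseteq> B}"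
  have "m = indicator_exponent A + (m - indicator_exponent A)"
  proof (rule poly_mapping_eqI)
    fix i
    have "Poly_Mapping.lookup m i \<noteq> 0" if "i \<in> A" using m that unfolding in_keys_iff[symmetric] by blast
    then show "Poly_Mapping.lookup m i =
        Poly_Mapping.lookup (indicator_exponent A + (m - indicator_exponent A)) i"
      by (simp add: lookup_add lookup_minus lookup_indicator_exponent)
  qed
  moreover have "Poly_Mapping.keys (m - indicator_exponent A) \<subseteq> B"
  proof
    fix i assume "i \<in> Poly_Mapping.keys (m - indicator_exponent A)"
    then have "i \<in> Poly_Mapping.keys m" by (simp add: in_keys_iff lookup_minus)
    then show "i \<in> B" using m by blast
  qed
  ultimately show "m \<in> monomial_cone (indicator_exponent A) B" unfolding monomial_cone_def by blast
qed (use assms in \<open>auto simp: monomial_cone_def keys_add_nat\<close>)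

text \<open>A monomial is divisible by a squarefree monomial of degree \<open>d\<close> exactly if
  at least \<open>d\<close> variables occur in it. Such monomials span the ideal, so membership
  becomes a condition on supports.\<close>

lemma squarefree_veronese_eq:
  "squarefree_veronese d = {p :: ('n::finite, 'k::field) mpoly. Poly_Mapping.keys p \<subseteq> {m. d \<le> card (Poly_Mapping.keys m)}}"
proof (intro subset_antisym)
  let ?I = "{p :: ('n, 'k) mpoly. Poly_Mapping.keys p \<subseteq> {m. d \<le> card (Poly_Mapping.keys m)}}"
  have "mpoly_module.subspace ?I"
    unfolding mpoly_module.subspace_def
  proof (intro conjI ballI allI)
    fix p q :: "('n, 'k) mpoly" assume "p \<in> ?I" "q \<in> ?I"
    then show "p + q \<in> ?I" using keys_add[of p q] by blast
  next
    fix p q :: "('n, 'k) mpoly" assume q: "q \<in> ?I"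
    have "d \<le> card (Poly_Mapping.keys (a + b))" if "b \<in> Poly_Mapping.keys q" for a b :: "'n \<Rightarrow>\<^sub>0 nat"
    proof -
      have "d \<le> card (Poly_Mapping.keys b)" using q that by auto
      also have "\<dots> \<le> card (Poly_Mapping.keys (a + b))" by (rule card_mono) (auto simp: keys_add_nat)
      finally show ?thesis .
    qed
    then show "p * q \<in> ?I" using keys_mult[of p q] by blast
  qed simp
  moreover have "squarefree_monomials d \<subseteq> ?I"
  proof
    fix p :: "('n, 'k) mpoly" assume "p \<in> squarefree_monomials d"
    then obtain m where m: "p = Poly_Mapping.single m 1" "\<And>i. Poly_Mapping.lookup m i \<le> 1"
        "(\<Sum>i\<in>UNIV. Poly_Mapping.lookup m i) = d"
      unfolding squarefree_monomials_def by auto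
    have "(\<Sum>i\<in>UNIV. Poly_Mapping.lookup m i) = (\<Sum>i\<in>Poly_Mapping.keys m. 1)"
    proof (rule sum.mono_neutral_cong_right)
      show "Poly_Mapping.lookup m i = 1" if "i \<in> Poly_Mapping.keys m" for i
        using m(2)[of i] that by (auto simp: in_keys_iff)
    qed (auto simp: in_keys_iff)
    then show "p \<in> ?I" using m by simp
  qed
  ultimately show "squarefree_veronese d \<subseteq> ?I"
    unfolding squarefree_veronese_def by (intro mpoly_module.span_minimal)
next
  show "{p :: ('n, 'k) mpoly. Poly_Mapping.keys p \<subseteq> {m. d \<le> card (Poly_Mapping.keys m)}} \<subseteq> squarefree_veronese d"
  proof
    fix p :: "('n, 'k) mpoly" assume p: "p \<in> {p. Poly_Mapping.keys p \<subseteq> {m. d \<le> card (Poly_Mapping.keys m)}}"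
    have "Poly_Mapping.single m c \<in> mpoly_module.span (squarefree_monomials d)"
      if "m \<in> Poly_Mapping.keys p" for m and c :: 'k
    proof -
      have "d \<le> card (Poly_Mapping.keys m)" using p that by blast
      then obtain A where A: "A \<subseteq> Poly_Mapping.keys m" "card A = d"
        by (rule obtain_subset_with_card_n)
      have "m \<in> monomial_cone (indicator_exponent A) UNIV" using A by (simp add: monomial_cone_indicator)
      then obtain b where b: "m = indicator_exponent A + b" unfolding monomial_cone_def by auto
      have "Poly_Mapping.single (indicator_exponent A) 1 \<in> (squarefree_monomials d :: ('n, 'k) mpoly set)"
        unfolding squarefree_monomials_def using A(2)
        by (intro CollectI exI[of _ "indicator_exponent A"]) (simp add: lookup_indicator_exponent sum.If_cases)
      then have "Poly_Mapping.single b c * Poly_Mapping.single (indicator_exponent A) 1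
          \<in> mpoly_module.span (squarefree_monomials d)"
        by (intro mpoly_module.span_scale mpoly_module.span_base)
      then show ?thesis using b by (simp add: mult_single add.commute)
    qed
    then have "(\<Sum>m\<in>Poly_Mapping.keys p. Poly_Mapping.single m (Poly_Mapping.lookup p m))
        \<in> mpoly_module.span (squarefree_monomials d)"
      by (intro mpoly_module.span_sum)
    then show "p \<in> squarefree_veronese d"
      unfolding squarefree_veronese_def poly_mapping_eq_sum_single[symmetric] .
  qed
qed

section \<open>The upper bound by counting\<close>

text \<open>Each homogeneous \<open>u i\<close> is a nonzero multiple of a monomial, so a Stanley
  decomposition of the ideal is a partition of its exponents into cones.\<close>

lemma stanley_decomposition_cones:
  assumes "stanley_decomposition (*) mpoly_grading (squarefree_veronese d :: ('n::finite, 'k::field) mpoly set) r u Z"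
  obtains a where "\<And>i. i < r \<Longrightarrow> d \<le> card (Poly_Mapping.keys (a i))"
    "(\<Union>i<r. monomial_cone (a i) (Z i)) = {m. d \<le> card (Poly_Mapping.keys m)}"
    "disjoint_family_on (\<lambda>i. monomial_cone (a i) (Z i)) {..<r}"
proof -
  let ?I = "squarefree_veronese d :: ('n, 'k) mpoly set"
  have u: "u i \<in> ?I" "\<exists>\<alpha>. u i \<in> mpoly_grading \<alpha>" "inj_on (\<lambda>p. p * u i) K[Z i]" if "i < r" for i
    using assms that unfolding stanley_decomposition_def by auto
  have "\<exists>a c. u i = Poly_Mapping.single a c \<and> c \<noteq> 0" if i: "i < r" for i
  proof -
    have "u i \<noteq> 0"
    proof
      assume "u i = 0"
      \<comment> \<open>Injectivity fails for \<open>u i = 0\<close>, as 0 and 1 in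
        \<open>K[Z i]\<close> would have the same product with it.\<close>
      then have "(0 :: ('n, 'k) mpoly) = 1" using u(3)[OF i]
        by (auto simp: poly_subring_def dest!: inj_onD[of _ _ 0 1])
      then show False by simp
    qed
    then show ?thesis using u(2)[OF i] homogeneous_eq_monomial by metis
  qed
  then obtain a c where ac: "\<And>i. i < r \<Longrightarrow> u i = Poly_Mapping.single (a i) (c i) \<and> c i \<noteq> 0" by metis
  have "Pi\<^sub>E {..<r} (\<lambda>i. stanley_space (*) (u i) (Z i))
      = Pi\<^sub>E {..<r} (\<lambda>i. {p :: ('n, 'k) mpoly. Poly_Mapping.keys p \<subseteq> monomial_cone (a i) (Z i)})"
  proof (rule PiE_cong)
    fix i assume "i \<in> {..<r}"
    then have "u i = Poly_Mapping.single (a i) (c i)" "c i \<noteq> 0" using ac by auto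
    then show "stanley_space (*) (u i) (Z i) = {p. Poly_Mapping.keys p \<subseteq> monomial_cone (a i) (Z i)}"
      by (simp add: stanley_space_monomial)
  qed
  then have "direct_sum_decomp r (\<lambda>i. {p :: ('n, 'k) mpoly. Poly_Mapping.keys p \<subseteq> monomial_cone (a i) (Z i)})
      {p. Poly_Mapping.keys p \<subseteq> {m. d \<le> card (Poly_Mapping.keys m)}}"
    using assms unfolding stanley_decomposition_def direct_sum_decomp_def squarefree_veronese_eq by simp
  then have "(\<Union>i<r. monomial_cone (a i) (Z i)) = {m. d \<le> card (Poly_Mapping.keys m)}"
    "disjoint_family_on (\<lambda>i. monomial_cone (a i) (Z i)) {..<r}"
    unfolding direct_sum_decomp_keys by auto
  moreover have "d \<le> card (Poly_Mapping.keys (a i))" if "i < r" for i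
    using u(1)[OF that] ac[OF that] unfolding squarefree_veronese_eq by auto
  ultimately show thesis using that by blast
qed

lemma sdepth_decomposition_le: "i < r \<Longrightarrow> sdepth_decomposition r Z \<le> card (Z i)"
  unfolding sdepth_decomposition_def by (rule Min_le) auto

lemma indicator_exponent_insert:
  "x \<notin> A \<Longrightarrow> indicator_exponent (insert x A) = indicator_exponent A + Poly_Mapping.single x 1"
  by (rule poly_mapping_eqI) (auto simp: lookup_indicator_exponent lookup_add lookup_single when_def)

text \<open>Every squarefree exponent \<open>A\<close> of degree \<open>d\<close> must be the
  generator of its cone. That cone contains \<open>insert z A\<close> for each \<open>z\<close> in
  \<open>Z (f A) - A\<close>, and by disjointness these sets of size \<open>d + 1\<close> are
  distinct for different pairs \<open>(A, z)\<close>. At least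
  \<open>sdepth_decomposition r Z - d\<close> values of \<open>z\<close> are available for each
  \<open>A\<close>.\<close>

lemma stanley_decomposition_veronese_bound:
  assumes dec: "stanley_decomposition (*) mpoly_grading
      (squarefree_veronese d :: ('n::finite, 'k::field) mpoly set) r u Z"
    and d: "d \<le> CARD('n)"
  shows "r > 0" "(sdepth_decomposition r Z - d) * (CARD('n) choose d) \<le> CARD('n) choose (d + 1)"
proof -
  obtain a where a: "\<And>i. i < r \<Longrightarrow> d \<le> card (Poly_Mapping.keys (a i))"
    "(\<Union>i<r. monomial_cone (a i) (Z i)) = {m. d \<le> card (Poly_Mapping.keys m)}"
    "disjoint_family_on (\<lambda>i. monomial_cone (a i) (Z i)) {..<r}"
    using stanley_decomposition_cones[OF dec] by blast
  let ?S = "{A :: 'n set. A \<subseteq> UNIV \<and> card A = d}"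
  have "\<exists>i<r. a i = indicator_exponent A" if A: "A \<in> ?S" for A
  proof -
    have "indicator_exponent A \<in> (\<Union>i<r. monomial_cone (a i) (Z i))" unfolding a(2) using A by simp
    then obtain i b where i: "i < r" "indicator_exponent A = a i + b" unfolding monomial_cone_def by auto
    \<comment> \<open>The monomial of \<open>a i\<close> divides that of \<open>A\<close>, and its
      support has at least \<open>d\<close> elements; so the support is all of
      \<open>A\<close>.\<close>
    have "Poly_Mapping.keys (a i) \<subseteq> A"
      using arg_cong[OF i(2), of Poly_Mapping.keys] by (auto simp: keys_add_nat)
    then have keys: "Poly_Mapping.keys (a i) = A" using A a(1)[OF i(1)] by (intro card_seteq) auto
    have "a i = indicator_exponent A"
    proof (rule poly_mapping_eqI)
      fix j
      have "Poly_Mapping.lookup (indicator_exponent A) j = Poly_Mapping.lookup (a i) j + Poly_Mapping.lookup b j"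
        unfolding i(2) lookup_add ..
      then show "Poly_Mapping.lookup (a i) j = Poly_Mapping.lookup (indicator_exponent A) j"
        using keys by (auto simp: lookup_indicator_exponent in_keys_iff split: if_splits)
    qed
    then show ?thesis using i(1) by blast
  qed
  then obtain f where f: "\<And>A. A \<in> ?S \<Longrightarrow> f A < r" "\<And>A. A \<in> ?S \<Longrightarrow> a (f A) = indicator_exponent A" by metis
  obtain A0 :: "'n set" where "card A0 = d" using d obtain_subset_with_card_n by blast
  then show "r > 0" using f(1)[of A0] by auto
  let ?W = "SIGMA A:?S. Z (f A) - A"
  have "inj_on (\<lambda>(A, z). insert z A) ?W"
  proof (rule inj_onI, clarify)
    fix A z B w assume A: "d = card A" "z \<in> Z (f A)" "z \<notin> A" and B: "card B = card A" "w \<in> Z (f B)" "w \<notin> B"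
      and eq: "insert z A = insert w B"
    have S: "A \<in> ?S" "B \<in> ?S" using A B by auto
    have "indicator_exponent (insert z A) \<in> monomial_cone (a (f A)) (Z (f A))"
      using f(2)[OF S(1)] A unfolding monomial_cone_def by (auto simp: indicator_exponent_insert)
    moreover have "indicator_exponent (insert w B) \<in> monomial_cone (a (f B)) (Z (f B))"
      using f(2)[OF S(2)] B unfolding monomial_cone_def by (auto simp: indicator_exponent_insert)
    ultimately have "f A = f B"
      using a(3) f(1)[OF S(1)] f(1)[OF S(2)] unfolding eq disjoint_family_on_def by blast
    then have "indicator_exponent A = indicator_exponent B" using f(2) S by metis
    then have "A = B" by (metis keys_indicator_exponent)
    moreover have "z = w" using eq A(3) B(3) unfolding \<open>A = B\<close> by blast
    ultimately show "A = B \<and> z = w" by simp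
  qed
  moreover have "(\<lambda>(A, z). insert z A) ` ?W \<subseteq> {A. A \<subseteq> UNIV \<and> card A = d + 1}" by auto
  ultimately have "card ?W \<le> card {A :: 'n set. A \<subseteq> UNIV \<and> card A = d + 1}"
    by (intro card_inj_on_le[of "\<lambda>(A, z). insert z A"]) auto
  also have "\<dots> = CARD('n) choose (d + 1)" by (rule n_subsets) simp
  finally have W: "card ?W \<le> CARD('n) choose (d + 1)" .
  have "(sdepth_decomposition r Z - d) * (CARD('n) choose d) = (\<Sum>A\<in>?S. sdepth_decomposition r Z - d)"
    using n_subsets[of "UNIV :: 'n set" d] by simp
  also have "\<dots> \<le> (\<Sum>A\<in>?S. card (Z (f A) - A))"
  proof (rule sum_mono)
    fix A assume A: "A \<in> ?S"
    have "sdepth_decomposition r Z \<le> card (Z (f A))" using sdepth_decomposition_le f(1)[OF A] by blast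
    then show "sdepth_decomposition r Z - d \<le> card (Z (f A) - A)"
      using diff_card_le_card_Diff[of A "Z (f A)"] A by simp
  qed
  also have "\<dots> = card ?W" by simp
  finally show "(sdepth_decomposition r Z - d) * (CARD('n) choose d) \<le> CARD('n) choose (d + 1)"
    using W by linarith
qed

text \<open>An interval \<open>[A, B]\<close> becomes the space \<open>x^A K[B]\<close>, and an
  exponent lies in its cone iff its support lies in the interval. The partition of supports
  therefore gives one of exponents.\<close>

lemma stanley_decomposition_of_interval_partition:
  assumes P: "interval_partition (UNIV :: 'n::finite set) d k P" and d: "d \<le> CARD('n)"
  shows "\<exists>r u Z. stanley_decomposition (*) mpoly_grading (squarefree_veronese d :: ('n, 'k::field) mpoly set) r u Z
    \<and> d + k \<le> sdepth_decomposition r Z"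
proof -
  have AB: "A \<subseteq> B" "d \<le> card A" "d + k \<le> card B" if "(A, B) \<in> P" for A B
    using P that unfolding interval_partition_def by auto
  have ex1: "\<exists>!I. I \<in> P \<and> fst I \<subseteq> C \<and> C \<subseteq> snd I" if "d \<le> card C" for C
    using P that unfolding interval_partition_def by simp
  have "finite P" by (rule finite_subset[of _ UNIV]) auto
  then obtain f where f: "bij_betw f {0..<card P} P" using ex_bij_betw_nat_finite by blast
  define r where "r = card P"
  have inj: "i = j" if "f i = f j" "i < r" "j < r" for i j
    using f that unfolding r_def bij_betw_def inj_on_def by auto
  have fP: "f i \<in> P" if "i < r" for i using f that unfolding r_def bij_betw_def by auto
  have surj: "\<exists>i<r. f i = I" if "I \<in> P" for I
    using f that unfolding r_def bij_betw_def by (metis atLeastLessThan_iff imageE)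
  define A where "A i = fst (f i)" for i
  define Z where "Z i = snd (f i)" for i
  define u :: "nat \<Rightarrow> ('n, 'k) mpoly" where "u i = Poly_Mapping.single (indicator_exponent (A i)) 1" for i
  have i: "A i \<subseteq> Z i" "d \<le> card (A i)" "d + k \<le> card (Z i)" if "i < r" for i
    using AB[of "A i" "Z i"] fP[OF that] unfolding A_def Z_def by auto
  have cone: "monomial_cone (indicator_exponent (A i)) (Z i)
      = {m. A i \<subseteq> Poly_Mapping.keys m \<and> Poly_Mapping.keys m \<subseteq> Z i}" if "i < r" for i
    using monomial_cone_indicator i(1)[OF that] .
  have "(\<Union>i<r. monomial_cone (indicator_exponent (A i)) (Z i)) = {m. d \<le> card (Poly_Mapping.keys m)}"
  proof (intro subset_antisym subsetI)
    fix m assume "m \<in> (\<Union>i<r. monomial_cone (indicator_exponent (A i)) (Z i))"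
    then obtain j where j: "j < r" "A j \<subseteq> Poly_Mapping.keys m" using cone by auto
    have "card (A j) \<le> card (Poly_Mapping.keys m)" using j(2) by (intro card_mono) auto
    then show "m \<in> {m. d \<le> card (Poly_Mapping.keys m)}" using i(2)[OF j(1)] by simp
  next
    fix m :: "'n \<Rightarrow>\<^sub>0 nat" assume "m \<in> {m. d \<le> card (Poly_Mapping.keys m)}"
    then obtain I where "I \<in> P" "fst I \<subseteq> Poly_Mapping.keys m" "Poly_Mapping.keys m \<subseteq> snd I"
      using ex1[of "Poly_Mapping.keys m"] by auto
    moreover obtain j where "j < r" "f j = I" using surj[OF \<open>I \<in> P\<close>] by auto
    ultimately show "m \<in> (\<Union>i<r. monomial_cone (indicator_exponent (A i)) (Z i))"
      using cone[of j] unfolding A_def Z_def by auto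
  qed
  moreover have "disjoint_family_on (\<lambda>i. monomial_cone (indicator_exponent (A i)) (Z i)) {..<r}"
    unfolding disjoint_family_on_def
  proof (intro ballI impI)
    fix j l assume jl: "j \<in> {..<r}" "l \<in> {..<r}" "j \<noteq> l"
    have False if "m \<in> monomial_cone (indicator_exponent (A j)) (Z j)"
      "m \<in> monomial_cone (indicator_exponent (A l)) (Z l)" for m
    proof -
      have m: "fst (f j) \<subseteq> Poly_Mapping.keys m" "Poly_Mapping.keys m \<subseteq> snd (f j)"
        "fst (f l) \<subseteq> Poly_Mapping.keys m" "Poly_Mapping.keys m \<subseteq> snd (f l)"
        using that cone jl unfolding A_def Z_def by auto
      have "card (A j) \<le> card (Poly_Mapping.keys m)" using m(1) unfolding A_def by (intro card_mono) auto
      then have "d \<le> card (Poly_Mapping.keys m)" using i(2)[of j] jl(1) by simp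
      from ex1[OF this] have "f j = f l" using m fP[of j] fP[of l] jl by (metis lessThan_iff)
      then show False using inj jl by auto
    qed
    then show "monomial_cone (indicator_exponent (A j)) (Z j) \<inter> monomial_cone (indicator_exponent (A l)) (Z l) = {}"
      by blast
  qed
  ultimately have "direct_sum_decomp r
      (\<lambda>i. {p :: ('n, 'k) mpoly. Poly_Mapping.keys p \<subseteq> monomial_cone (indicator_exponent (A i)) (Z i)})
      (squarefree_veronese d)"
    unfolding squarefree_veronese_eq direct_sum_decomp_keys by blast
  moreover have "stanley_space (*) (u i) (Z i)
      = {p. Poly_Mapping.keys p \<subseteq> monomial_cone (indicator_exponent (A i)) (Z i)}" for i
    unfolding u_def by (rule stanley_space_monomial) simp
  ultimately have "direct_sum_decomp r (\<lambda>i. stanley_space (*) (u i) (Z i)) (squarefree_veronese d)" by simp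
  moreover have "u i \<in> squarefree_veronese d" if "i < r" for i
    unfolding u_def squarefree_veronese_eq using i(2)[OF that] by simp
  moreover have "\<exists>\<alpha>. u i \<in> mpoly_grading \<alpha>" for i
    unfolding u_def mpoly_grading_def
    by (intro exI[of _ "\<lambda>j. int (Poly_Mapping.lookup (indicator_exponent (A i)) j)"]) simp
  moreover have "inj_on (\<lambda>p. p * u i) K[Z i]" for i
    unfolding u_def using inj_mult_monomial[of "1 :: 'k"] by (rule inj_on_subset) auto
  ultimately have dec: "stanley_decomposition (*) mpoly_grading (squarefree_veronese d) r u Z"
    unfolding stanley_decomposition_def by blast
  \<comment> \<open>The minimum below must range over a nonempty set; since \<open>d\<close> does
    not exceed the number of variables, the ideal is nonzero and cannot have an empty
    decomposition.\<close>
  have "r > 0" by (rule stanley_decomposition_veronese_bound(1)[OF dec d])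
  then have "d + k \<le> sdepth_decomposition r Z"
    unfolding sdepth_decomposition_def using i(3) by (subst Min_ge_iff) auto
  then show ?thesis using dec by blast
qed

text \<open>The interval partition supplies a decomposition, and all Stanley depths are at most the
  number of variables. So \<open>Max\<close> ranges over a finite nonempty set: it is at least any
  member and is itself attained by a decomposition, to which the counting bound applies.\<close>

lemma
  fixes I :: "('n::finite, 'k::field) mpoly set"
  assumes P: "interval_partition (UNIV :: 'n set) d k P" and d: "d \<le> CARD('n)"
    and I: "I = squarefree_veronese d"
  shows sdepth_veronese_lower: "d + k \<le> sdepth_ideal I"
    and sdepth_veronese_upper: "(sdepth_ideal I - d) * (CARD('n) choose d) \<le> CARD('n) choose (d + 1)"
proof -
  let ?D = "{sdepth_decomposition r Z |r (u :: nat \<Rightarrow> ('n, 'k) mpoly) Z. stanley_decomposition (*) mpoly_grading I r u Z}"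
  have "sdepth_decomposition r Z \<le> CARD('n)"
    if "stanley_decomposition (*) mpoly_grading I r u Z" for r u and Z :: "nat \<Rightarrow> 'n set"
  proof -
    have "r > 0" using stanley_decomposition_veronese_bound(1)[OF _ d] that I by blast
    then have "sdepth_decomposition r Z \<le> card (Z 0)" by (rule sdepth_decomposition_le)
    also have "\<dots> \<le> CARD('n)" by (rule card_mono) auto
    finally show ?thesis .
  qed
  then have fin: "finite ?D" by (intro finite_subset[of ?D "{..CARD('n)}"]) auto
  obtain r and u :: "nat \<Rightarrow> ('n, 'k) mpoly" and Z where
    dec: "stanley_decomposition (*) mpoly_grading I r u Z" "d + k \<le> sdepth_decomposition r Z"
    using stanley_decomposition_of_interval_partition[OF P d] I by metis
  then have mem: "sdepth_decomposition r Z \<in> ?D" by blast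
  show "d + k \<le> sdepth_ideal I"
    unfolding sdepth_def using Max_ge[OF fin mem] dec(2) by linarith
  have "sdepth_ideal I \<in> ?D" unfolding sdepth_def using fin mem by (intro Max_in) auto
  then show "(sdepth_ideal I - d) * (CARD('n) choose d) \<le> CARD('n) choose (d + 1)"
    using stanley_decomposition_veronese_bound(2)[OF _ d] I by fastforce
qed

section \<open>The quotient of binomial coefficients and the conclusion\<close>

text \<open>Both \<open>Suc d * (n choose Suc d)\<close> and \<open>(n - d) * (n choose d)\<close>
  equal \<open>n * ((n - 1) choose d)\<close>.\<close>

lemma binomial_Suc_ratio:
  assumes "d \<le> n"
  shows "real (n choose (d + 1)) / real (n choose d) = real (n - d) / real (d + 1)"
proof -
  have "Suc d * (n choose Suc d) = (n - d) * (n choose d)"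
    by (simp only: binomial_absorption binomial_absorb_comp)
  then have "real (Suc d) * real (n choose Suc d) = real (n - d) * real (n choose d)"
    by (metis of_nat_mult)
  moreover have "n choose d > 0" using assms by simp
  ultimately show ?thesis by (simp add: field_simps)
qed

theorem theorem1p1:
  fixes n d :: nat
    and I :: "('n::finite, 'k::field) mpoly set"
  assumes n: "n = CARD('n)"
    and I: "I = squarefree_veronese d"
  shows "(1 \<le> d \<and> d \<le> n \<and> n < 5 * d + 4 \<longrightarrow>
        int (sdepth_ideal I) = \<lfloor>real (n choose (d + 1)) / real (n choose d)\<rfloor> + int d)
      \<and> (1 \<le> d \<and> 5 * d + 4 \<le> n \<longrightarrow>
        d + 3 \<le> sdepth_ideal I \<and>
        int (sdepth_ideal I) \<le> \<lfloor>real (n choose (d + 1)) / real (n choose d)\<rfloor> + int d)"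
proof -
  let ?q = "\<lfloor>real (n choose (d + 1)) / real (n choose d)\<rfloor>"
  have upper: "int (sdepth_ideal I) \<le> ?q + int d" if "d \<le> n"
  proof -
    have "(sdepth_ideal I - d) * (n choose d) \<le> n choose (d + 1)"
      using sdepth_veronese_upper[OF interval_partition_trivial _ I] that n by simp
    then have "real (sdepth_ideal I - d) * real (n choose d) \<le> real (n choose (d + 1))"
      by (simp flip: of_nat_mult)
    moreover have "n choose d > 0" using that by simp
    ultimately have "real (sdepth_ideal I - d) \<le> real (n choose (d + 1)) / real (n choose d)"
      by (simp add: pos_le_divide_eq)
    then have "int (sdepth_ideal I - d) \<le> ?q" by (simp add: le_floor_iff)
    then show ?thesis by linarith
  qed
  have lower: "d + k \<le> sdepth_ideal I" if k: "d \<le> n" "k \<le> 3" "k = 0 \<or> Suc k * d + k \<le> n" for k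
  proof -
    consider "k = 0" | "k \<le> 2" "Suc k * d + k \<le> n" | "k = 3" "4 * d + 3 \<le> n"
      using k by (cases "k = 3") auto
    then have "\<exists>P. interval_partition (UNIV :: 'n set) d k P"
    proof cases
      case 1
      then show ?thesis using interval_partition_trivial by blast
    next
      case 2
      then show ?thesis using n by (intro interval_partition_exists_le2) auto
    next
      case 3
      then show ?thesis using n interval_partition_exists_3[of "UNIV :: 'n set" d] by auto
    qed
    then show ?thesis using sdepth_veronese_lower[OF _ _ I] k(1) n by blast
  qed
  have "int (sdepth_ideal I) = ?q + int d" if "d \<le> n" "n < 5 * d + 4"
  proof -
    \<comment> \<open>\<open>k\<close> is the floor itself, because the quotient of binomial
      coefficients is \<open>(n - d) / (d + 1)\<close>.\<close>
    define k where "k = (n - d) div (d + 1)"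
    have q: "?q = int k"
      unfolding binomial_Suc_ratio[OF that(1)] k_def by (rule floor_divide_of_nat_eq)
    have k: "k * (d + 1) \<le> n - d" unfolding k_def by (rule div_times_less_eq_dividend)
    \<comment> \<open>The bound \<open>n < 5 * d + 4\<close> enters here: it means that the floor is
      at most 3, the range covered by \<open>lower\<close>.\<close>
    have "n - d < 4 * (d + 1)" using that by simp
    then have "k < 4" unfolding k_def by (simp add: less_mult_imp_div_less)
    moreover have "Suc k * d + k \<le> n" using k that(1) by (simp add: algebra_simps)
    ultimately have "d + k \<le> sdepth_ideal I" using that(1) by (intro lower) auto
    then show ?thesis using upper[OF that(1)] q by linarith
  qed
  moreover have "d + 3 \<le> sdepth_ideal I" if "5 * d + 4 \<le> n"
    using that by (intro lower) auto
  moreover have "d \<le> n" if "5 * d + 4 \<le> n" using that by simp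
  ultimately show ?thesis using upper by blast
qed

end
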